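(* Let $(X_n)_{n\ge 0}$ be a positive Harris recurrent Markov chain on $\mathbb{R}^d$ with stationary probability measure $\mu$. Fix a measurable recurrency set $A$ with $\mu(A)\in(0,1)$ and let $B_\ell$ be measurable sets parametrized by $\ell$, such that $\gamma_\ell:=\mu(B_\ell)>0$ and $\gamma_\ell\to0$ as $\ell\to\infty$. Let $\hat\gamma_\ell:=\hat\alpha_A\cdot\hat T_{B_\ell}$ be the Recurrent Multilevel Splitting (RMS) estimator of $\gamma_\ell$, where $\hat\alpha_A$ is the batch-means estimator of $\alpha_A$ and $\hat T_{B_\ell}$ is the Multilevel Splitting estimator of $T_{B_\ell}$ (see context). Assume: (a) the estimators $\hat\alpha_A$ and $\hat T_{B_\ell}$ are independent; (b) for each $\ell$ (writing $B=B_\ell$) the following two conditions hold: (I) for all $k\in\{1,\dots,m\}$, $\mathbb{P}(D_k\mid D_{k-1},X_{\tau_{k-1}})\equiv\mathbb{P}(D_k\mid D_{k-1})=p_k$; and (II) the conditional law of $R_1$ given $\{R_1>0\}$ and $X_{\tau_m}$ does not depend on $X_{\tau_m}$, i.e. it equals the law of $R_+$; (c) the cost of sampling one path in stage $k$ of the Multilevel Splitting algorithm equals $1$ for every $k\in\{0,\dots,m\}$, irrespective of the entrance state; (d) for all sufficiently small $\delta>0$, $$\limsup_{\ell\to\infty}\frac{\mathrm{Var}(R_+)}{(\mathbb{E}R_+)^2}<\infty,\qquad \lim_{\ell\to\infty}T_{B_\ell}\cdot p_{B_\ell}^{-\delta}=0$$ (where $R_+=R_+(\ell)$ depends on $\ell$).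 Then the RMS estimator $\hat\gamma_\ell$ with the optimal choice of the Multilevel Splitting parameters (given in the context, for a fixed accuracy $\rho>0$ not depending on $\ell$) is logarithmically efficient, i.e. $$\lim_{\ell\to\infty}\frac{W(\hat\gamma_\ell)\cdot\mathrm{Var}(\hat\gamma_\ell)}{\gamma_\ell^{2-\varepsilon}}=0\qquad\text{for all }\varepsilon>0.$$
   Context: Cycle quantities. $\alpha_A:=\mathbb{P}_\mu(X_0\notin A,X_1\in A)$, where $\mathbb{P}_\mu$ is the law of the chain with $X_0\sim\mu$. Let $\pi_A(C):=\mathbb{P}_\mu(X_1\in C\mid X_0\notin A,X_1\in A)$ be the stationary cycle-origin distribution, and let $\mathbb{P},\mathbb{E}$, when used for cycle quantities, refer to the chain started at time $0$ from $X_0\sim\pi_A$. For $B=B_\ell$: $\tau_B:=\inf\{n>0:X_n\in B\}$, $\tau_A^{\mathrm{in}}:=\inf\{n>0:X_{n-1}\notin A,X_n\in A\}$, $R_1:=\sum_{n=0}^{\tau_A^{\mathrm{in}}-1}\mathbf{1}\{X_n\in B\}$, $T_B:=\mathbb{E}[R_1]$, $p_B:=\mathbb{P}(\tau_B<\tau_A^{\mathrm{in}})=\mathbb{P}(R_1>0)$, and $R_+$ is a random variable with the law of $R_1$ conditioned on $R_1>0$. Then $\gamma_\ell=\alpha_AT_{B_\ell}$ and $T_B=p_B\,\mathbb{E}R_+$. Relative error: for an estimator $\hat\Psi$ of $\Psi>0$, $\mathrm{RE}^2(\hat\Psi):=\mathbb{E}(\hat\Psi-\Psi)^2/\Psi^2$;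 also $\mathrm{RE}^2(R_+):=\mathrm{Var}(R_+)/(\mathbb{E}R_+)^2$. $W(\cdot)$ denotes the (expected) workload of an estimator; $W(\hat\gamma_\ell)=W(\hat\alpha_A)+W(\hat T_{B_\ell})$. Estimator of $\alpha_A$. $\hat\alpha_A$ is the batch-means estimator: a stationary path of the chain ($X_0\sim\mu$) of fixed length $N$ is divided into a fixed number $b$ of batches of equal length $M=[N/b]$; $\hat\alpha_k:=\frac1M\sum_{n=(k-1)M+1}^{kM}\mathbf{1}\{X_{n-1}\notin A,X_n\in A\}$ and $\hat\alpha_A:=\frac1b\sum_{k=1}^b\hat\alpha_k$. Since $A$ is fixed, $\hat\alpha_A$, $\mathrm{RE}(\hat\alpha_A)$ and $W(\hat\alpha_A)<\infty$ do not depend on $\ell$. Multilevel Splitting (MLS). For each $\ell$ one uses an importance function $H:\mathbb{R}^d\to[0,1]$ with $H(x)=1$ iff $x\in B$ and $H(x)=0$ on $A$, thresholds $0=h_0<h_1<\dots<h_m=1$, and splitting factors $n_0,\dots,n_m$. Put $\tau_k:=\inf\{n\ge0:H(X_n)\ge h_k\}$, $D_k:=\{\tau_k<\tau_A^{\mathrm{in}}\}$, $p_0:=1$, $p_k:=\mathbb{P}(D_k\mid D_{k-1})$, so $p_B=\prod_{k=1}^mp_k$. The algorithm: start with $r_0=1$ state sampled from $\pi_A$; in stage $k=0,\dots,m-1$, from each of the $r_k$ entrance states (path positions at time $\tau_k$) generate $n_k$ independent continuations until $\min\{\tau_{k+1},\tau_A^{\mathrm{in}}\}$ and let $r_{k+1}$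 be the number for which $D_{k+1}$ occurs, keeping their states at time $\tau_{k+1}$; in stage $m$, from each of the $r_m$ entrance states to $B$ generate $n_m$ independent continuations until $\tau_A^{\mathrm{in}}$ and let $r_{m+1}$ be the total time spent in $B$ by these continuations over times $\tau_m,\dots,\tau_A^{\mathrm{in}}-1$. Then $\hat T_B:=r_{m+1}/\prod_{k=0}^mn_k$ (equal to $0$ if some $r_k=0$, $k\leq m$). This is an unbiased estimator of $T_B$. With unit path costs its expected workload, and under (I)–(II) its squared relative error, are $$W(\hat T_B)=\sum_{k=0}^m\prod_{j=0}^kn_jp_j,\qquad \mathrm{RE}^2(\hat T_B)=\sum_{k=1}^m\frac{(1-p_k)/p_k}{\prod_{j=0}^{k-1}n_jp_j}+\frac{\mathrm{RE}^2(R_+)}{\prod_{j=0}^mn_jp_j}.$$ Optimal parameters. Fix $\rho>0$ and let $c\approx0.6275$ be the solution of $\exp(1/c)=2c/(2c-1)$. The optimal parameters, which minimize $W(\hat T_B)$ subject to $\mathrm{RE}^2(\hat T_B)\le\rho$, with $m$ and $n_k$ relaxed to be positive real numbers, are $$m=c\,|\log p_B|,\quad p_k=p_{\mathrm{opt}}:=\tfrac{2c-1}{2c}\ (1\le k\le m),\quad n_0=\frac{1}{\rho\sqrt{2c-1}}\Big(\frac{c\,|\log p_B|}{\sqrt{2c-1}}+\mathrm{RE}(R_+)\Big),$$ $$n_k=1/p_{\mathrm{opt}}\ (1\le k\le m-1),\qquad n_m=\mathrm{RE}(R_+)\cdot\frac{2c}{\sqrt{2c-1}}.$$ "MLS with the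 optimal choice of parameters" is understood in this relaxed sense (integrality of $m$ and the $n_k$ is ignored): $\hat T_{B_\ell}$ is an unbiased estimator of $T_{B_\ell}$ whose squared relative error and workload are the values, at the optimal parameters, of the expressions $\sum_{k=1}^m\frac{(1-p_k)/p_k}{\prod_{j=0}^{k-1}n_jp_j}+\frac{\mathrm{RE}^2(R_+)}{\prod_{j=0}^mn_jp_j}$ and $\sum_{k=0}^m\prod_{j=0}^kn_jp_j$, respectively, namely $$\mathrm{RE}^2(\hat T_{B_\ell})=\rho,\qquad W(\hat T_{B_\ell})=\frac1\rho\Big(\frac{c\,|\log p_{B_\ell}|}{\sqrt{2c-1}}+\mathrm{RE}(R_+)\Big)^2.$$ *)

theory Defs
  imports "HOL-Probability.Probability"
begin

section \<open>Markov chains\<close>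

abbreviation path_space :: "(nat \<Rightarrow> 'a::topological_space) measure" where
  "path_space \<equiv> PiM UNIV (\<lambda>_. borel)"

text \<open>Law on path space of the chain with transition kernel \<open>K\<close> and initial law \<open>\<nu>\<close>:
  the projective limit of the Ionescu-Tulcea construction applied to
  \<open>X\<^sub>0 \<sim> \<nu>\<close> and \<open>X\<^sub>n\<^sub>+\<^sub>1 \<sim> K X\<^sub>n\<close>. The lemmas below confirm the construction applies.\<close>

definition chain_step :: "('a \<Rightarrow> 'a measure) \<Rightarrow> 'a measure \<Rightarrow> nat \<Rightarrow> (nat \<Rightarrow> 'a) \<Rightarrow> 'a measure" where
  "chain_step K \<nu> n \<omega> = (case n of 0 \<Rightarrow> \<nu> | Suc i \<Rightarrow> K (\<omega> i))"

definition path_law :: "('a::topological_space \<Rightarrow> 'a measure) \<Rightarrow> 'a measure \<Rightarrow> (nat \<Rightarrow> 'a) measure" where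
  "path_law K \<nu> =
     projective_family.lim UNIV (Ionescu_Tulcea.CI (chain_step K \<nu>) (\<lambda>_. borel)) (\<lambda>_. borel)"

lemma Ionescu_Tulcea_chain_step:
  assumes K: "K \<in> borel \<rightarrow>\<^sub>M prob_algebra borel" and \<nu>: "\<nu> \<in> space (prob_algebra borel)"
  shows "Ionescu_Tulcea (chain_step K \<nu>) (\<lambda>_. borel :: 'a::topological_space measure)"
proof (rule Ionescu_Tulcea.intro)
  fix i :: nat
  show "chain_step K \<nu> i \<in> measurable (PiM {0..<i} (\<lambda>_. borel)) (subprob_algebra borel)"
  proof (cases i)
    case 0
    have "\<nu> \<in> space (subprob_algebra borel)"
      using \<nu> by (auto simp: space_prob_algebra space_subprob_algebra prob_space_imp_subprob_space)
    then show ?thesis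
      by (simp add: 0 chain_step_def[abs_def])
  next
    case (Suc j)
    have "(\<lambda>\<omega>. K (\<omega> j)) \<in> measurable (PiM {0..<Suc j} (\<lambda>_. borel)) (subprob_algebra borel)"
      by (rule measurable_compose[OF _ measurable_prob_algebraD[OF K]]) simp
    then show ?thesis
      by (simp add: Suc chain_step_def[abs_def])
  qed
  show "prob_space (chain_step K \<nu> i x)" if "x \<in> space (PiM {0..<i} (\<lambda>_. borel))" for x
    using \<nu> measurable_space[OF K]
    by (auto simp: chain_step_def space_prob_algebra split: nat.split)
qed

lemma
  assumes K: "K \<in> borel \<rightarrow>\<^sub>M prob_algebra borel" and \<nu>: "\<nu> \<in> space (prob_algebra borel)"
  shows prob_space_path_law: "prob_space (path_law K \<nu>)"
    and sets_path_law: "sets (path_law K \<nu>) = sets (path_space :: (nat \<Rightarrow> 'a::topological_space) measure)"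
proof -
  interpret Ionescu_Tulcea "chain_step K \<nu>" "\<lambda>_. borel"
    by (rule Ionescu_Tulcea_chain_step[OF K \<nu>])
  show "sets (path_law K \<nu>) = sets path_space"
    by (simp add: path_law_def PF.sets_lim)
  have "prob_space (distr PF.lim (PiM {} (\<lambda>_. borel)) (\<lambda>x. restrict x {}))"
    unfolding distr_lim[OF finite.emptyI] by (rule PF.prob_space_P) auto
  then show "prob_space (path_law K \<nu>)"
    unfolding path_law_def
    by (rule prob_space_distrD[rotated])
       (simp only: measurable_cong_sets[OF PF.sets_lim refl] measurable_restrict_subset[OF empty_subsetI])
qed

text \<open>Harris recurrence in its classical form: for some nontrivial \<open>\<sigma>\<close>-finite \<open>\<phi>\<close>, every \<open>\<phi>\<close>-positive
  set is visited infinitely often almost surely, from \<^emph>\<open>every\<close> starting state.\<close>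

definition harris_recurrent :: "('a::topological_space \<Rightarrow> 'a measure) \<Rightarrow> bool" where
  "harris_recurrent K \<longleftrightarrow>
     (\<exists>\<phi>. sets \<phi> = sets borel \<and> sigma_finite_measure \<phi> \<and> emeasure \<phi> UNIV \<noteq> 0 \<and>
        (\<forall>C\<in>sets borel. emeasure \<phi> C \<noteq> 0 \<longrightarrow>
           (\<forall>x. AE \<omega> in path_law K (return borel x). \<exists>\<^sub>\<infinity>n. \<omega> n \<in> C)))"

definition positive_harris_chain :: "('a::topological_space \<Rightarrow> 'a measure) \<Rightarrow> 'a measure \<Rightarrow> bool" where
  "positive_harris_chain K \<mu> \<longleftrightarrow>
     K \<in> borel \<rightarrow>\<^sub>M prob_algebra borel \<and> harris_recurrent K \<and>
     sets \<mu> = sets borel \<and> prob_space \<mu> \<and> \<mu> \<bind> K = \<mu>"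


section \<open>Recurrency cycles\<close>

definition first_time :: "(nat \<Rightarrow> bool) \<Rightarrow> enat" where
  "first_time P = (INF n\<in>{n. P n}. enat n)"

definition hit_time :: "'a set \<Rightarrow> (nat \<Rightarrow> 'a) \<Rightarrow> enat" where
  "hit_time B \<omega> = first_time (\<lambda>n. 0 < n \<and> \<omega> n \<in> B)"

definition entry_time :: "'a set \<Rightarrow> (nat \<Rightarrow> 'a) \<Rightarrow> enat" where
  "entry_time A \<omega> = first_time (\<lambda>n. 0 < n \<and> \<omega> (n - 1) \<notin> A \<and> \<omega> n \<in> A)"

definition cycle_rate :: "('a::topological_space \<Rightarrow> 'a measure) \<Rightarrow> 'a measure \<Rightarrow> 'a set \<Rightarrow> real" where
  "cycle_rate K \<mu> A = measure (path_law K \<mu>) {\<omega>. \<omega> 0 \<notin> A \<and> \<omega> 1 \<in> A}"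

definition cycle_origin :: "('a::topological_space \<Rightarrow> 'a measure) \<Rightarrow> 'a measure \<Rightarrow> 'a set \<Rightarrow> 'a measure" where
  "cycle_origin K \<mu> A =
     distr (uniform_measure (path_law K \<mu>) {\<omega>. \<omega> 0 \<notin> A \<and> \<omega> 1 \<in> A}) borel (\<lambda>\<omega>. \<omega> 1)"

definition cycle_law :: "('a::topological_space \<Rightarrow> 'a measure) \<Rightarrow> 'a measure \<Rightarrow> 'a set \<Rightarrow> (nat \<Rightarrow> 'a) measure" where
  "cycle_law K \<mu> A = path_law K (cycle_origin K \<mu> A)"

text \<open>\<open>R\<^sub>1\<close>. For a positive Harris chain the counted set is infinite only on a null event,
  so the value \<open>0\<close> of \<^const>\<open>card\<close> there is immaterial.\<close>

definition cycle_visits :: "'a set \<Rightarrow> 'a set \<Rightarrow> (nat \<Rightarrow> 'a) \<Rightarrow> nat" where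
  "cycle_visits A B \<omega> = card {n. enat n < entry_time A \<omega> \<and> \<omega> n \<in> B}"

definition mean_visits ::
  "('a::topological_space \<Rightarrow> 'a measure) \<Rightarrow> 'a measure \<Rightarrow> 'a set \<Rightarrow> 'a set \<Rightarrow> real" where
  "mean_visits K \<mu> A B = (\<integral>\<omega>. real (cycle_visits A B \<omega>) \<partial>cycle_law K \<mu> A)"

definition hit_prob ::
  "('a::topological_space \<Rightarrow> 'a measure) \<Rightarrow> 'a measure \<Rightarrow> 'a set \<Rightarrow> 'a set \<Rightarrow> real" where
  "hit_prob K \<mu> A B = measure (cycle_law K \<mu> A) {\<omega>. hit_time B \<omega> < entry_time A \<omega>}"

definition Rplus_law ::
  "('a::topological_space \<Rightarrow> 'a measure) \<Rightarrow> 'a measure \<Rightarrow> 'a set \<Rightarrow> 'a set \<Rightarrow> real measure" where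
  "Rplus_law K \<mu> A B =
     distr (uniform_measure (cycle_law K \<mu> A) {\<omega>. 0 < cycle_visits A B \<omega>}) borel
       (\<lambda>\<omega>. real (cycle_visits A B \<omega>))"


section \<open>Relative errors\<close>

text \<open>Extended-valued, so that an estimator without second moment has infinite relative error
  (a Bochner integral would silently be \<open>0\<close>).\<close>

definition sq_rel_err :: "'w measure \<Rightarrow> ('w \<Rightarrow> real) \<Rightarrow> real \<Rightarrow> ennreal" where
  "sq_rel_err \<Omega> Y \<psi> = (\<integral>\<^sup>+w. ennreal ((Y w - \<psi>)\<^sup>2) \<partial>\<Omega>) / ennreal (\<psi>\<^sup>2)"

text \<open>\<open>Var R\<^sub>+ / (E R\<^sub>+)\<^sup>2\<close>\<close>

definition sq_rel_err_Rplus ::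
  "('a::topological_space \<Rightarrow> 'a measure) \<Rightarrow> 'a measure \<Rightarrow> 'a set \<Rightarrow> 'a set \<Rightarrow> ennreal" where
  "sq_rel_err_Rplus K \<mu> A B =
     sq_rel_err (Rplus_law K \<mu> A B) (\<lambda>r. r) (\<integral>r. r \<partial>Rplus_law K \<mu> A B)"

definition rel_err_Rplus ::
  "('a::topological_space \<Rightarrow> 'a measure) \<Rightarrow> 'a measure \<Rightarrow> 'a set \<Rightarrow> 'a set \<Rightarrow> real" where
  "rel_err_Rplus K \<mu> A B = sqrt (enn2real (sq_rel_err_Rplus K \<mu> A B))"


section \<open>The batch-means estimator\<close>

definition batch_mean :: "'a set \<Rightarrow> nat \<Rightarrow> (nat \<Rightarrow> 'w \<Rightarrow> 'a) \<Rightarrow> nat \<Rightarrow> 'w \<Rightarrow> real" where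
  "batch_mean A M X k w =
     (\<Sum>n = (k - 1) * M + 1..k * M. of_bool (X (n - 1) w \<notin> A \<and> X n w \<in> A)) / real M"

definition batch_means_estimator ::
  "'a set \<Rightarrow> nat \<Rightarrow> nat \<Rightarrow> (nat \<Rightarrow> 'w \<Rightarrow> 'a) \<Rightarrow> 'w \<Rightarrow> real" where
  "batch_means_estimator A N b X w = (\<Sum>k = 1..b. batch_mean A (N div b) X k w) / real b"


section \<open>Multilevel splitting\<close>

definition splitting_levels ::
  "('a::topological_space \<Rightarrow> real) \<Rightarrow> nat \<Rightarrow> (nat \<Rightarrow> real) \<Rightarrow> 'a set \<Rightarrow> 'a set \<Rightarrow> bool" where
  "splitting_levels H m h A B \<longleftrightarrow>
     H \<in> borel_measurable borel \<and> range H \<subseteq> {0..1} \<and>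
     (\<forall>x. H x = 1 \<longleftrightarrow> x \<in> B) \<and> (\<forall>x\<in>A. H x = 0) \<and>
     0 < m \<and> h 0 = 0 \<and> h m = 1 \<and> strict_mono_on {0..m} h"

definition level_time :: "('a \<Rightarrow> real) \<Rightarrow> real \<Rightarrow> (nat \<Rightarrow> 'a) \<Rightarrow> enat" where
  "level_time H t \<omega> = first_time (\<lambda>n. t \<le> H (\<omega> n))"

definition reaches :: "('a \<Rightarrow> real) \<Rightarrow> real \<Rightarrow> 'a set \<Rightarrow> (nat \<Rightarrow> 'a) \<Rightarrow> bool" where
  "reaches H t A \<omega> \<longleftrightarrow> level_time H t \<omega> < entry_time A \<omega>"

definition entrance_state :: "('a \<Rightarrow> real) \<Rightarrow> real \<Rightarrow> (nat \<Rightarrow> 'a) \<Rightarrow> 'a" where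
  "entrance_state H t \<omega> = \<omega> (the_enat (level_time H t \<omega>))"

text \<open>Conditional probability of \<open>E\<close> given the random state \<open>Z\<close>, under \<open>M\<close> conditioned on \<open>G\<close>.\<close>

definition cond_prob_given ::
  "(nat \<Rightarrow> 'a) measure \<Rightarrow> (nat \<Rightarrow> 'a) set \<Rightarrow> ((nat \<Rightarrow> 'a) \<Rightarrow> 'a::topological_space)
     \<Rightarrow> (nat \<Rightarrow> 'a) set \<Rightarrow> (nat \<Rightarrow> 'a) \<Rightarrow> real" where
  "cond_prob_given M G Z E =
     real_cond_exp (uniform_measure M G) (vimage_algebra (space M) Z borel) (indicator E)"

definition condition_I ::
  "('a::topological_space \<Rightarrow> 'a measure) \<Rightarrow> 'a measure \<Rightarrow> 'a set
     \<Rightarrow> ('a \<Rightarrow> real) \<Rightarrow> nat \<Rightarrow> (nat \<Rightarrow> real) \<Rightarrow> bool" where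
  "condition_I K \<mu> A H m h \<longleftrightarrow>
     (\<forall>k\<in>{1..m}.
        AE \<omega> in uniform_measure (cycle_law K \<mu> A) {\<omega>. reaches H (h (k - 1)) A \<omega>}.
          cond_prob_given (cycle_law K \<mu> A) {\<omega>. reaches H (h (k - 1)) A \<omega>}
            (entrance_state H (h (k - 1))) {\<omega>. reaches H (h k) A \<omega>} \<omega>
          = \<P>(\<omega> in cycle_law K \<mu> A. reaches H (h k) A \<omega> \<bar> reaches H (h (k - 1)) A \<omega>))"

definition condition_II ::
  "('a::topological_space \<Rightarrow> 'a measure) \<Rightarrow> 'a measure \<Rightarrow> 'a set \<Rightarrow> 'a set
     \<Rightarrow> ('a \<Rightarrow> real) \<Rightarrow> nat \<Rightarrow> (nat \<Rightarrow> real) \<Rightarrow> bool" where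
  "condition_II K \<mu> A B H m h \<longleftrightarrow>
     (\<forall>S\<in>sets borel.
        AE \<omega> in uniform_measure (cycle_law K \<mu> A) {\<omega>. 0 < cycle_visits A B \<omega>}.
          cond_prob_given (cycle_law K \<mu> A) {\<omega>. 0 < cycle_visits A B \<omega>}
            (entrance_state H (h m)) {\<omega>. real (cycle_visits A B \<omega>) \<in> S} \<omega>
          = measure (Rplus_law K \<mu> A B) S)"

text \<open>\<open>cost k x\<close>: cost of sampling one path in stage \<open>k\<close> from the entrance state \<open>x\<close>.\<close>

definition unit_path_costs :: "nat \<Rightarrow> (nat \<Rightarrow> 'a \<Rightarrow> real) \<Rightarrow> bool" where
  "unit_path_costs m cost \<longleftrightarrow> (\<forall>k\<le>m. \<forall>x. cost k x = 1)"

text \<open>Workload (for unit path costs) and squared relative error of multilevel splitting with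
  splitting factors \<open>n\<close>, level probabilities \<open>p\<close> (\<open>p 0 = 1\<close>) and \<open>e = RE\<^sup>2(R\<^sub>+)\<close>.\<close>

definition mls_workload :: "nat \<Rightarrow> (nat \<Rightarrow> real) \<Rightarrow> (nat \<Rightarrow> real) \<Rightarrow> real" where
  "mls_workload m n p = (\<Sum>k = 0..m. \<Prod>j = 0..k. n j * p j)"

definition mls_sq_rel_err :: "nat \<Rightarrow> (nat \<Rightarrow> real) \<Rightarrow> (nat \<Rightarrow> real) \<Rightarrow> real \<Rightarrow> real" where
  "mls_sq_rel_err m n p e =
     (\<Sum>k = 1..m. ((1 - p k) / p k) / (\<Prod>j = 0..<k. n j * p j)) + e / (\<Prod>j = 0..m. n j * p j)"

text \<open>The optimal \<open>m\<close> and \<open>n k\<close> are real numbers, with \<open>p k = q\<close> for all \<open>k \<ge> 1\<close> and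
  \<open>n k = 1 / q\<close> for the interior stages. For such parameters the sums collapse to the
  following expressions, which make sense for real \<open>m\<close>; \<open>n0\<close> and \<open>nm\<close> are the splitting
  factors of the first and the last stage.\<close>

definition mls_workload_relaxed :: "real \<Rightarrow> real \<Rightarrow> real \<Rightarrow> real \<Rightarrow> real" where
  "mls_workload_relaxed m q n0 nm = m * n0 + n0 * (nm * q)"

definition mls_sq_rel_err_relaxed :: "real \<Rightarrow> real \<Rightarrow> real \<Rightarrow> real \<Rightarrow> real \<Rightarrow> real" where
  "mls_sq_rel_err_relaxed m q n0 nm e = m * (((1 - q) / q) / n0) + e / (n0 * (nm * q))"

lemma mls_relaxed_eq:
  assumes m: "0 < m" and q: "q \<noteq> 0"
    and p: "p 0 = 1" "\<And>k. 1 \<le> k \<Longrightarrow> k \<le> m \<Longrightarrow> p k = q"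
    and n: "n 0 = n0" "\<And>k. 1 \<le> k \<Longrightarrow> k < m \<Longrightarrow> n k = 1 / q" "n m = nm"
  shows "mls_workload m n p = mls_workload_relaxed (real m) q n0 nm"
    and "mls_sq_rel_err m n p e = mls_sq_rel_err_relaxed (real m) q n0 nm e"
proof -
  have pr: "(\<Prod>j = 0..<Suc k. n j * p j) = n0" if "k < m" for k
    using that by (induction k) (use q p n in auto)
  have pr': "(\<Prod>j = 0..k. n j * p j) = n0" if "k < m" for k
    using pr[OF that] by (simp add: atLeastLessThanSuc_atLeastAtMost)
  have prm: "(\<Prod>j = 0..m. n j * p j) = n0 * (nm * q)"
  proof -
    obtain k where k: "m = Suc k" using m by (cases m) auto
    show ?thesis using pr'[of k] n(3) p(2)[of m] by (simp add: k)
  qed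
  have "(\<Sum>k = 0..m. \<Prod>j = 0..k. n j * p j) = (\<Sum>k<m. \<Prod>j = 0..k. n j * p j) + n0 * (nm * q)"
    using prm by (simp add: atMost_atLeast0[symmetric] lessThan_Suc_atMost[symmetric])
  also have "(\<Sum>k<m. \<Prod>j = 0..k. n j * p j) = (\<Sum>k<m. n0)"
    by (intro sum.cong refl pr') auto
  finally show "mls_workload m n p = mls_workload_relaxed (real m) q n0 nm"
    by (simp add: mls_workload_def mls_workload_relaxed_def)
  have "(\<Sum>k = 1..m. ((1 - p k) / p k) / (\<Prod>j = 0..<k. n j * p j))
      = (\<Sum>k = 1..m. ((1 - q) / q) / n0)"
  proof (intro sum.cong refl)
    fix k assume "k \<in> {1..m}"
    then obtain i where "k = Suc i" "i < m" "p k = q" using p(2)[of k] by (cases k) auto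
    then show "((1 - p k) / p k) / (\<Prod>j = 0..<k. n j * p j) = ((1 - q) / q) / n0"
      using pr[of i] by simp
  qed
  then show "mls_sq_rel_err m n p e = mls_sq_rel_err_relaxed (real m) q n0 nm e"
    by (simp add: mls_sq_rel_err_def mls_sq_rel_err_relaxed_def prm)
qed

text \<open>The constant \<open>c \<approx> 0.6275\<close>\<close>

definition mls_c :: real where
  "mls_c = (THE c. exp (1 / c) = 2 * c / (2 * c - 1))"

lemma mls_c_ex1: "\<exists>!c::real. exp (1 / c) = 2 * c / (2 * c - 1)"
proof -
  define g where "g u = (2 - u) * exp u" for u :: real
  have deriv: "(g has_real_derivative (1 - u) * exp u) (at u)" for u
    unfolding g_def by (auto intro!: derivative_eq_intros simp: algebra_simps)
  have cont: "continuous_on S g" for S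
    unfolding g_def by (intro continuous_intros)
  have up: "g x < g y" if "x < y" "y \<le> 1" for x y
    by (rule DERIV_pos_imp_increasing_open[OF \<open>x < y\<close>])
       (use that in \<open>auto intro!: cont exI[of _ "(1 - _) * exp _"] deriv mult_pos_pos\<close>)
  have down: "g y < g x" if "x < y" "1 \<le> x" for x y
    by (rule DERIV_neg_imp_decreasing_open[OF \<open>x < y\<close>])
       (use that in \<open>auto intro!: cont exI[of _ "(1 - _) * exp _"] deriv mult_neg_pos\<close>)
  have g0: "g 0 = 2" by (simp add: g_def)
  have "2 < g 1" using up[of 0 1] g0 by simp
  then obtain u where u: "1 \<le> u" "u \<le> 2" "g u = 2"
    using IVT2'[of g 2 2 1] cont by (auto simp: g_def)
  have uniq: "v = u" if "g v = 2" "v \<noteq> 0" for v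
  proof -
    have "\<not> v < 0" using up[of v 0] g0 that by auto
    moreover have "\<not> (0 < v \<and> v \<le> 1)" using up[of 0 v] g0 that by auto
    ultimately have "1 \<le> v" using that by linarith
    then show ?thesis using down[of u v] down[of v u] u that by (cases u v rule: linorder_cases) auto
  qed
  have iff: "exp (1 / c) = 2 * c / (2 * c - 1) \<longleftrightarrow> c \<noteq> 0 \<and> g (1 / c) = 2" for c :: real
  proof (cases "c = 0 \<or> 2 * c - 1 = 0")
    case True
    then consider "c = 0" | "c = 1 / 2" by linarith
    then show ?thesis
    proof cases
      case 1
      show ?thesis unfolding 1 by simp
    next
      case 2
      show ?thesis unfolding 2 by (simp add: g_def)
    qed
  next
    case False
    then have "g (1 / c) = (2 * c - 1) * exp (1 / c) / c" by (simp add: g_def field_simps)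
    then show ?thesis using False by (auto simp: field_simps)
  qed
  show ?thesis
  proof (rule ex1I[of _ "1 / u"])
    show "exp (1 / (1 / u)) = 2 * (1 / u) / (2 * (1 / u) - 1)"
      unfolding iff using u by auto
    show "c = 1 / u" if "exp (1 / c) = 2 * c / (2 * c - 1)" for c
    proof -
      have "1 / c = u" using that uniq[of "1 / c"] unfolding iff by simp
      then show ?thesis by auto
    qed
  qed
qed

text \<open>Optimal parameters for target accuracy \<open>\<rho>\<close>, as functions of
  \<open>L = \<bar>ln p\<^sub>B\<bar>\<close> and \<open>r = RE(R\<^sub>+)\<close>.\<close>

definition opt_m :: "real \<Rightarrow> real" where
  "opt_m L = mls_c * L"

definition opt_p :: real where
  "opt_p = (2 * mls_c - 1) / (2 * mls_c)"

definition opt_n_first :: "real \<Rightarrow> real \<Rightarrow> real \<Rightarrow> real" where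
  "opt_n_first \<rho> L r =
     1 / (\<rho> * sqrt (2 * mls_c - 1)) * (mls_c * L / sqrt (2 * mls_c - 1) + r)"

definition opt_n_last :: "real \<Rightarrow> real" where
  "opt_n_last r = r * (2 * mls_c / sqrt (2 * mls_c - 1))"

text \<open>\<open>T\<close> is the multilevel splitting estimator run with the optimal (relaxed) parameters and
  \<open>W\<close> its expected workload. Only unbiasedness is unconditional: the error formula holds under the two
  entrance-state conditions, the workload formula under unit path costs.\<close>

definition optimal_mls ::
  "('a::topological_space \<Rightarrow> 'a measure) \<Rightarrow> 'a measure \<Rightarrow> 'a set \<Rightarrow> 'a set
     \<Rightarrow> ('a \<Rightarrow> real) \<Rightarrow> nat \<Rightarrow> (nat \<Rightarrow> real) \<Rightarrow> (nat \<Rightarrow> 'a \<Rightarrow> real)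
     \<Rightarrow> real \<Rightarrow> 'w measure \<Rightarrow> ('w \<Rightarrow> real) \<Rightarrow> real \<Rightarrow> bool" where
  "optimal_mls K \<mu> A B H m h cost \<rho> \<Omega> T W \<longleftrightarrow>
     (let L = \<bar>ln (hit_prob K \<mu> A B)\<bar>; r = rel_err_Rplus K \<mu> A B in
       integrable \<Omega> T \<and> (\<integral>w. T w \<partial>\<Omega>) = mean_visits K \<mu> A B \<and>
       (condition_I K \<mu> A H m h \<and> condition_II K \<mu> A B H m h \<longrightarrow>
          sq_rel_err \<Omega> T (mean_visits K \<mu> A B) =
            ennreal (mls_sq_rel_err_relaxed (opt_m L) opt_p (opt_n_first \<rho> L r) (opt_n_last r) (r\<^sup>2))) \<and>
       (unit_path_costs m cost \<longrightarrow>
          W = mls_workload_relaxed (opt_m L) opt_p (opt_n_first \<rho> L r) (opt_n_last r)))"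

lemma opt_closed_form:
  assumes "0 < \<rho>" "0 \<le> L" "0 \<le> r"
  shows "0 < L \<or> 0 < r \<Longrightarrow>
      mls_sq_rel_err_relaxed (opt_m L) opt_p (opt_n_first \<rho> L r) (opt_n_last r) (r\<^sup>2) = \<rho>"
    and "mls_workload_relaxed (opt_m L) opt_p (opt_n_first \<rho> L r) (opt_n_last r) =
      1 / \<rho> * (mls_c * L / sqrt (2 * mls_c - 1) + r)\<^sup>2"
proof -
  have eq: "exp (1 / mls_c) = 2 * mls_c / (2 * mls_c - 1)"
    unfolding mls_c_def by (rule theI'[OF mls_c_ex1])
  have c: "1 / 2 < mls_c"
  proof (rule ccontr)
    assume "\<not> 1 / 2 < mls_c"
    then have le: "mls_c \<le> 1 / 2" by simp
    have pos: "0 < 2 * mls_c / (2 * mls_c - 1)" unfolding eq[symmetric] by simp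
    then have neg: "mls_c < 0" using le by (auto simp: zero_less_divide_iff)
    define v where "v = - (1 / mls_c)"
    have v: "0 < v" using neg by (simp add: v_def)
    have "exp v = (2 * mls_c - 1) / (2 * mls_c)"
      unfolding v_def exp_minus eq by simp
    also have "\<dots> = 1 + v / 2" using neg by (simp add: v_def field_simps)
    finally show False using exp_ge_add_one_self[of v] v by simp
  qed
  define s where "s = sqrt (2 * mls_c - 1)"
  have s: "0 < s" "2 * mls_c - 1 = s\<^sup>2" "mls_c = (s\<^sup>2 + 1) / 2" using c by (auto simp: s_def)
  define Y where "Y = mls_c * L / s + r"
  have n0: "opt_n_first \<rho> L r = Y / (\<rho> * s)"
    by (simp add: opt_n_first_def Y_def s_def)
  have opt_p_eq: "opt_p = s\<^sup>2 / (2 * mls_c)"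
    by (simp only: opt_p_def s(2))
  have nm: "opt_n_last r * opt_p = r * s"
  proof -
    have "opt_n_last r * opt_p = r * (2 * mls_c / s) * (s\<^sup>2 / (2 * mls_c))"
      by (simp only: opt_n_last_def opt_p_eq s_def)
    also have "\<dots> = r * s" using s(1) c by (simp add: power2_eq_square)
    finally show ?thesis .
  qed
  have q: "(1 - opt_p) / opt_p = 1 / s\<^sup>2"
  proof -
    have "1 - opt_p = 1 / (2 * mls_c)" using c by (simp add: opt_p_def field_simps)
    then show ?thesis using c s(1) by (simp add: opt_p_eq)
  qed
  show "mls_workload_relaxed (opt_m L) opt_p (opt_n_first \<rho> L r) (opt_n_last r) =
      1 / \<rho> * (mls_c * L / sqrt (2 * mls_c - 1) + r)\<^sup>2"
  proof -
    have "mls_workload_relaxed (opt_m L) opt_p (opt_n_first \<rho> L r) (opt_n_last r)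
        = Y / (\<rho> * s) * (mls_c * L + r * s)"
      by (simp only: mls_workload_relaxed_def n0 nm opt_m_def) (simp only: algebra_simps)
    also have "mls_c * L + r * s = s * Y" using s(1) by (simp add: Y_def field_simps)
    also have "Y / (\<rho> * s) * (s * Y) = 1 / \<rho> * Y\<^sup>2"
      using s(1) assms(1) by (simp add: power2_eq_square)
    finally show ?thesis by (simp add: Y_def s_def)
  qed
  assume "0 < L \<or> 0 < r"
  then have Y: "0 < Y"
  proof
    assume "0 < L"
    then have "0 < mls_c * L / s" using c s(1) by simp
    then show ?thesis using assms by (simp add: Y_def)
  next
    assume "0 < r"
    moreover have "0 \<le> mls_c * L / s" using c s(1) assms by simp
    ultimately show ?thesis by (simp add: Y_def)
  qed
  have "mls_sq_rel_err_relaxed (opt_m L) opt_p (opt_n_first \<rho> L r) (opt_n_last r) (r\<^sup>2)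
      = mls_c * L * (1 / s\<^sup>2 / (Y / (\<rho> * s))) + r\<^sup>2 / (Y / (\<rho> * s) * (r * s))"
    by (simp only: mls_sq_rel_err_relaxed_def n0 nm q opt_m_def)
  also have "\<dots> = \<rho> / Y * (mls_c * L / s + r)"
    using s(1) Y assms(1) by (cases "r = 0") (auto simp: field_simps power2_eq_square)
  also have "\<dots> = \<rho>" using Y by (simp add: Y_def)
  finally show "mls_sq_rel_err_relaxed (opt_m L) opt_p (opt_n_first \<rho> L r) (opt_n_last r) (r\<^sup>2) = \<rho>" .
qed

end

theory Submission
  imports Defs
begin

text \<open>
  Everything is compared with powers of \<open>T = T\<^sub>B\<close>. Writing \<open>p = p\<^sub>B\<close>, the workload is at most a
  constant times \<open>1 + (ln p)\<^sup>2\<close>, because the optimal workload is a square in \<open>\<bar>ln p\<bar>\<close> and the relative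
  error of \<open>R\<^sub>+\<close>, which stays bounded (\<open>mls_workload_relaxed_opt_le\<close>). The variance is at most a
  constant times \<open>T\<^sup>2\<close>: the batch-means estimator takes values in \<open>[0, 1]\<close>, and a relative error of at
  most \<open>\<rho>\<close> bounds the second moment of the splitting estimator by \<open>(1 + \<rho>) * T\<^sup>2\<close>
  (\<open>variance_bounded_times_le\<close>).

  The denominator is handled by the cycle inequality \<open>\<alpha> * T \<le> \<gamma>\<close> (\<open>cycle_rate_mean_visits_le\<close>), in
  which the rate \<open>\<alpha>\<close> is positive (\<open>cycle_rate_pos\<close>) and the same for all rare sets. It gives
  \<open>T\<^sup>2 / \<gamma> powr (2 - \<epsilon>) \<le> const * T powr e\<close> for \<open>e = min \<epsilon> 2\<close>, and it forces \<open>T\<close> to \<open>0\<close>. There remains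
  \<open>(1 + (ln p)\<^sup>2) * T powr e\<close>. Its first part vanishes since \<open>T\<close> does. For the second, split
  \<open>T powr e = (T * p powr (- \<delta>)) powr e * p powr (\<delta> * e)\<close>: the first factor tends to \<open>0\<close> by
  assumption, and the second one absorbs the squared logarithm (\<open>tendsto_ln_sq_times_powr\<close>).

  The two probabilistic facts rest on one structural tool: a law on path space is determined by its
  initial distribution and the Markov property (\<open>path_law_eqI\<close>). Hence the stationary path, seen one
  step later and conditioned on entering \<open>A\<close> in that step, is the cycle law
  (\<open>shift_conditioned_path_law\<close>), so \<open>\<alpha> * T\<close> is a sum over \<open>n\<close> of stationary probabilities of being
  in \<open>B\<close>, \<open>n\<close> steps after an entry to \<open>A\<close> that no other entry has followed. By stationarity all
  these events may be moved so that the visit to \<open>B\<close> is at one common time \<open>N\<close>; then they are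
  disjoint, as they prescribe different times of the last entry up to \<open>N\<close>, and their
  probabilities add up to at most \<open>\<gamma>\<close>.

  If \<open>\<alpha>\<close> were \<open>0\<close>, the stationary chain would almost surely neither enter nor leave \<open>A\<close>. Discarding a
  null set, one sees that both \<open>A\<close> and its complement would contain a point from which the chain
  almost surely never leaves the set, although by Harris recurrence one of them, the same for all
  starting points, is almost surely visited infinitely often.
\<close>

section \<open>Kernels\<close>

lemma kernel_nn_integral_measurable:
  assumes "K \<in> borel \<rightarrow>\<^sub>M prob_algebra borel" "g \<in> borel_measurable borel"
  shows "(\<lambda>x. \<integral>\<^sup>+y. g y \<partial>K x) \<in> borel_measurable borel"
  using assms by (intro nn_integral_measurable_subprob_algebra2[where N=borel] measurable_prob_algebraD) simp_all

lemma kernel_sets: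
  assumes "K \<in> borel \<rightarrow>\<^sub>M prob_algebra borel"
  shows "sets (K x) = sets borel"
  using measurable_space[OF assms, of x] by (simp add: space_prob_algebra)

lemma kernel_emeasure_measurable:
  assumes K: "K \<in> borel \<rightarrow>\<^sub>M prob_algebra borel" and S: "S \<in> sets borel"
  shows "(\<lambda>x. emeasure (K x) S) \<in> borel_measurable borel"
  using kernel_nn_integral_measurable[OF K, of "indicator S"] S by (simp add: kernel_sets[OF K])

section \<open>The Markov property and uniqueness of path laws\<close>

text \<open>The one-step Markov property, tested only on cylinders with measurable sides. These suffice to
  determine the law, and they are stable under shifting the path by one step.\<close>

definition markov_property ::
  "('a::topological_space \<Rightarrow> 'a measure) \<Rightarrow> (nat \<Rightarrow> 'a) measure \<Rightarrow> bool" where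
  "markov_property K M \<longleftrightarrow>
     (\<forall>n C. \<forall>g\<in>borel_measurable borel. (\<forall>i. C i \<in> sets borel) \<longrightarrow>
        (\<integral>\<^sup>+\<omega>. indicator {\<omega>. \<forall>i\<le>n. \<omega> i \<in> C i} \<omega> * g (\<omega> (Suc n)) \<partial>M) =
        (\<integral>\<^sup>+\<omega>. indicator {\<omega>. \<forall>i\<le>n. \<omega> i \<in> C i} \<omega> * (\<integral>\<^sup>+y. g y \<partial>K (\<omega> n)) \<partial>M))"

lemma space_path_space: "space (path_space :: (nat \<Rightarrow> 'a::topological_space) measure) = UNIV"
  by (simp add: space_PiM)

lemma cylinder_in_sets:
  fixes C :: "nat \<Rightarrow> 'a::topological_space set"
  assumes [measurable]: "\<And>i. C i \<in> sets borel"
  shows "{\<omega>. \<forall>i\<le>n. \<omega> i \<in> C i} \<in> sets path_space"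
proof -
  have "Measurable.pred path_space (\<lambda>\<omega>. \<forall>i\<le>n. \<omega> i \<in> C i)"
    by measurable
  then show ?thesis
    by (simp add: pred_def space_path_space)
qed

text \<open>The Ionescu-Tulcea measures on the first \<open>n\<close> coordinates are built by attaching a coordinate at
  a time, and both claims are read off from the step that attaches the last coordinate.\<close>

lemma
  fixes K :: "'a::topological_space \<Rightarrow> 'a measure"
  assumes K: "K \<in> borel \<rightarrow>\<^sub>M prob_algebra borel" and \<nu>: "\<nu> \<in> space (prob_algebra borel)"
  shows initial_law_path_law: "distr (path_law K \<nu>) borel (\<lambda>\<omega>. \<omega> 0) = \<nu>"
    and markov_property_path_law: "markov_property K (path_law K \<nu>)"
proof -
  interpret IT: Ionescu_Tulcea "chain_step K \<nu>" "\<lambda>_. borel"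
    by (rule Ionescu_Tulcea_chain_step[OF K \<nu>])
  let ?P = "path_law K \<nu>"
  let ?c = "\<lambda>_. undefined :: 'a"
  have sP[measurable_cong]: "sets ?P = sets path_space"
    by (rule sets_path_law[OF K \<nu>])
  have c: "?c \<in> space (PiM {0..<0} (\<lambda>_. borel))"
    by (simp add: space_PiM PiE_iff extensional_def)
  have up: "IT.up_to {0..<n} = n" for n
    unfolding IT.up_to_def by (rule Least_equality) (force simp: not_le)+
  have marg: "(\<integral>\<^sup>+\<omega>. f (restrict \<omega> {0..<n}) \<partial>?P) = (\<integral>\<^sup>+\<xi>. f \<xi> \<partial>IT.C 0 n ?c)"
    if f[measurable]: "f \<in> borel_measurable (PiM {0..<n} (\<lambda>_. borel))" for f :: "(nat \<Rightarrow> 'a) \<Rightarrow> ennreal" and n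
  proof -
    have "(\<integral>\<^sup>+\<omega>. f (restrict \<omega> {0..<n}) \<partial>?P)
        = (\<integral>\<^sup>+\<xi>. f \<xi> \<partial>distr ?P (PiM {0..<n} (\<lambda>_. borel)) (\<lambda>\<omega>. restrict \<omega> {0..<n}))"
      by (subst nn_integral_distr) (auto intro!: measurable_restrict)
    also have "distr ?P (PiM {0..<n} (\<lambda>_. borel)) (\<lambda>\<omega>. restrict \<omega> {0..<n}) = IT.CI {0..<n}"
      unfolding path_law_def by (rule IT.distr_lim) simp
    also have "(\<integral>\<^sup>+\<xi>. f \<xi> \<partial>IT.CI {0..<n}) = (\<integral>\<^sup>+\<xi>. f (restrict \<xi> {0..<n}) \<partial>IT.C 0 n ?c)"
      using IT.sets_C[OF c, of n] unfolding IT.CI_def up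
      by (subst nn_integral_distr) (auto intro!: measurable_restrict cong: measurable_cong_sets)
    also have "\<dots> = (\<integral>\<^sup>+\<xi>. f \<xi> \<partial>IT.C 0 n ?c)"
      using IT.space_C[OF c, of n]
      by (intro nn_integral_cong) (auto simp: space_PiM PiE_def intro!: arg_cong[where f=f] extensional_restrict)
    finally show ?thesis .
  qed
  have step: "(\<integral>\<^sup>+\<omega>. f (restrict \<omega> {0..<Suc n}) \<partial>?P)
      = (\<integral>\<^sup>+\<xi>. \<integral>\<^sup>+y. f (\<xi>(n := y)) \<partial>chain_step K \<nu> n \<xi> \<partial>IT.C 0 n ?c)"
    if f[measurable]: "f \<in> borel_measurable (PiM {0..<Suc n} (\<lambda>_. borel))" for f :: "(nat \<Rightarrow> 'a) \<Rightarrow> ennreal" and n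
  proof -
    have "(\<integral>\<^sup>+\<omega>. f (restrict \<omega> {0..<Suc n}) \<partial>?P) = (\<integral>\<^sup>+\<xi>. f \<xi> \<partial>(IT.C 0 n ?c \<bind> IT.eP n))"
      by (simp only: marg[OF f] IT.C.simps add_0)
    also have "\<dots> = (\<integral>\<^sup>+\<xi>. \<integral>\<^sup>+\<zeta>. f \<zeta> \<partial>IT.eP n \<xi> \<partial>IT.C 0 n ?c)"
      using IT.sets_C[OF c, of n] IT.measurable_eP[of n]
      by (intro nn_integral_bind[OF f]) (auto cong: measurable_cong_sets)
    also have "\<dots> = (\<integral>\<^sup>+\<xi>. \<integral>\<^sup>+y. f (\<xi>(n := y)) \<partial>chain_step K \<nu> n \<xi> \<partial>IT.C 0 n ?c)"
      using IT.space_C[OF c, of n]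
      by (intro nn_integral_cong IT.nn_integral_eP[OF _ f]) auto
    finally show ?thesis .
  qed
  show "distr ?P borel (\<lambda>\<omega>. \<omega> 0) = \<nu>"
  proof (rule measure_eqI)
    have s\<nu>: "sets \<nu> = sets borel" using \<nu> by (simp add: space_prob_algebra)
    then show "sets (distr ?P borel (\<lambda>\<omega>. \<omega> 0)) = sets \<nu>" by simp
    fix S assume "S \<in> sets (distr ?P borel (\<lambda>\<omega>. \<omega> 0))"
    then have S[measurable]: "S \<in> sets borel" by simp
    have m: "(\<lambda>\<xi>. indicator S (\<xi> 0) :: ennreal) \<in> borel_measurable (PiM {0..<Suc 0} (\<lambda>_. borel))"
      by measurable
    have "emeasure (distr ?P borel (\<lambda>\<omega>. \<omega> 0)) S = (\<integral>\<^sup>+x. indicator S x \<partial>distr ?P borel (\<lambda>\<omega>. \<omega> 0))"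
      by simp
    also have "\<dots> = (\<integral>\<^sup>+\<omega>. indicator S (restrict \<omega> {0..<Suc 0} 0) \<partial>?P)"
      by (subst nn_integral_distr) auto
    also have "\<dots> = (\<integral>\<^sup>+\<xi>. \<integral>\<^sup>+y. indicator S y \<partial>\<nu> \<partial>IT.C 0 0 ?c)"
      by (subst step[OF m]) (simp add: chain_step_def)
    also have "\<dots> = emeasure \<nu> S"
      using S s\<nu> prob_space.emeasure_space_1[OF IT.prob_space_C[OF c, of 0]] by (simp del: IT.C.simps)
    finally show "emeasure (distr ?P borel (\<lambda>\<omega>. \<omega> 0)) S = emeasure \<nu> S" .
  qed
  show "markov_property K ?P"
    unfolding markov_property_def
  proof (intro allI ballI impI)
    fix n :: nat and C :: "nat \<Rightarrow> 'a set" and g :: "'a \<Rightarrow> ennreal"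
    assume g[measurable]: "g \<in> borel_measurable borel" and "\<forall>i. C i \<in> sets borel"
    then have C[measurable]: "C i \<in> sets borel" for i by simp
    note Kg[measurable] = kernel_nn_integral_measurable[OF K g]
    let ?I = "\<lambda>\<xi>. indicator {\<omega>. \<forall>i\<le>n. \<omega> i \<in> C i} \<xi> :: ennreal"
    have I[measurable]: "?I \<in> borel_measurable (PiM {0..<k} (\<lambda>_. borel))" if "Suc n \<le> k" for k
    proof -
      have "?I = (\<lambda>\<xi>. \<Prod>i\<le>n. indicator (C i) (\<xi> i))"
        by (auto simp: fun_eq_iff indicator_def prod_eq_1_iff)
      also have "\<dots> \<in> borel_measurable (PiM {0..<k} (\<lambda>_. borel))"
        using that by (intro borel_measurable_prod_ennreal) auto
      finally show ?thesis .
    qed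
    have "(\<integral>\<^sup>+\<omega>. ?I \<omega> * g (\<omega> (Suc n)) \<partial>?P)
        = (\<integral>\<^sup>+\<omega>. ?I (restrict \<omega> {0..<Suc (Suc n)}) * g (restrict \<omega> {0..<Suc (Suc n)} (Suc n)) \<partial>?P)"
      by (intro nn_integral_cong) (simp add: indicator_def)
    also have "\<dots> = (\<integral>\<^sup>+\<xi>. \<integral>\<^sup>+y. ?I (\<xi>(Suc n := y)) * g ((\<xi>(Suc n := y)) (Suc n)) \<partial>chain_step K \<nu> (Suc n) \<xi> \<partial>IT.C 0 (Suc n) ?c)"
      by (rule step) (intro borel_measurable_times_ennreal I, simp, measurable)
    also have "\<dots> = (\<integral>\<^sup>+\<xi>. \<integral>\<^sup>+y. ?I \<xi> * g y \<partial>K (\<xi> n) \<partial>IT.C 0 (Suc n) ?c)"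
      by (intro nn_integral_cong) (simp add: indicator_def chain_step_def)
    also have "\<dots> = (\<integral>\<^sup>+\<xi>. ?I \<xi> * (\<integral>\<^sup>+y. g y \<partial>K (\<xi> n)) \<partial>IT.C 0 (Suc n) ?c)"
    proof (intro nn_integral_cong nn_integral_cmult)
      show "g \<in> borel_measurable (K x)" for x
        using measurable_space[OF K, of x] by (auto simp: space_prob_algebra cong: measurable_cong_sets)
    qed
    also have "\<dots> = (\<integral>\<^sup>+\<omega>. ?I (restrict \<omega> {0..<Suc n}) * (\<integral>\<^sup>+y. g y \<partial>K (restrict \<omega> {0..<Suc n} n)) \<partial>?P)"
      by (rule marg[symmetric]) (intro borel_measurable_times_ennreal I measurable_compose[OF _ Kg], simp, measurable)
    also have "\<dots> = (\<integral>\<^sup>+\<omega>. ?I \<omega> * (\<integral>\<^sup>+y. g y \<partial>K (\<omega> n)) \<partial>?P)"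
      by (intro nn_integral_cong) (simp add: indicator_def)
    finally show "(\<integral>\<^sup>+\<omega>. ?I \<omega> * g (\<omega> (Suc n)) \<partial>?P) = (\<integral>\<^sup>+\<omega>. ?I \<omega> * (\<integral>\<^sup>+y. g y \<partial>K (\<omega> n)) \<partial>?P)" .
  qed
qed

lemma markov_propertyD:
  assumes "markov_property K M" "\<And>i. C i \<in> sets borel" "g \<in> borel_measurable borel"
  shows "(\<integral>\<^sup>+\<omega>. indicator {\<omega>. \<forall>i\<le>n. \<omega> i \<in> C i} \<omega> * g (\<omega> (Suc n)) \<partial>M) =
    (\<integral>\<^sup>+\<omega>. indicator {\<omega>. \<forall>i\<le>n. \<omega> i \<in> C i} \<omega> * (\<integral>\<^sup>+y. g y \<partial>K (\<omega> n)) \<partial>M)"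
  using assms unfolding markov_property_def by blast

text \<open>Two laws agree once they agree on cylinders. Integrating a function of the last coordinate over a
  cylinder of length \<open>n + 1\<close> reduces, by the Markov property, to integrating its image under the
  kernel over a cylinder of length \<open>n\<close>; for this induction the function has to be arbitrary.\<close>

lemma path_law_eqI:
  fixes K :: "'a::topological_space \<Rightarrow> 'a measure"
  assumes K: "K \<in> borel \<rightarrow>\<^sub>M prob_algebra borel"
    and sM: "sets M = sets path_space" and M: "prob_space M" and mM: "markov_property K M"
  shows "M = path_law K (distr M borel (\<lambda>\<omega>. \<omega> 0))"
proof -
  define \<nu> where "\<nu> = distr M borel (\<lambda>\<omega>. \<omega> 0)"
  have m0: "(\<lambda>\<omega>. \<omega> i) \<in> M \<rightarrow>\<^sub>M borel" for i
    by (simp add: measurable_cong_sets[OF sM refl])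
  have \<nu>: "\<nu> \<in> space (prob_algebra borel)"
    unfolding \<nu>_def by (simp add: space_prob_algebra prob_space.prob_space_distr[OF M m0])
  let ?P = "path_law K \<nu>"
  have sP: "sets ?P = sets path_space" by (rule sets_path_law[OF K \<nu>])
  have mP: "markov_property K ?P" by (rule markov_property_path_law[OF K \<nu>])
  have m0': "(\<lambda>\<omega>. \<omega> i) \<in> ?P \<rightarrow>\<^sub>M borel" for i
    by (simp add: measurable_cong_sets[OF sP refl])
  have split: "indicator {\<omega>. \<forall>i\<le>Suc n. \<omega> i \<in> C i} \<omega> * g (\<omega> (Suc n))
      = indicator {\<omega>. \<forall>i\<le>n. \<omega> i \<in> C i} \<omega> * (indicator (C (Suc n)) (\<omega> (Suc n)) * g (\<omega> (Suc n)))"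
    for n and C :: "nat \<Rightarrow> 'a set" and \<omega> and g :: "'a \<Rightarrow> ennreal"
    by (auto simp: indicator_def le_Suc_eq)
  have eq: "(\<integral>\<^sup>+\<omega>. indicator {\<omega>. \<forall>i\<le>n. \<omega> i \<in> C i} \<omega> * g (\<omega> n) \<partial>M)
      = (\<integral>\<^sup>+\<omega>. indicator {\<omega>. \<forall>i\<le>n. \<omega> i \<in> C i} \<omega> * g (\<omega> n) \<partial>?P)"
    if [measurable]: "\<And>i. C i \<in> sets borel" "g \<in> borel_measurable borel" for n and C :: "nat \<Rightarrow> 'a set" and g
    using that(2)
  proof (induction n arbitrary: g)
    case (0 g)
    note [measurable] = 0
    have "(\<integral>\<^sup>+\<omega>. indicator {\<omega>. \<forall>i\<le>0. \<omega> i \<in> C i} \<omega> * g (\<omega> 0) \<partial>Q) = (\<integral>\<^sup>+x. indicator (C 0) x * g x \<partial>\<nu>)"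
      if "distr Q borel (\<lambda>\<omega>. \<omega> 0) = \<nu>" "(\<lambda>\<omega>. \<omega> 0) \<in> Q \<rightarrow>\<^sub>M borel" for Q :: "(nat \<Rightarrow> 'a) measure"
      unfolding that(1)[symmetric] using that(2)
      by (subst nn_integral_distr) (auto simp: indicator_def intro!: nn_integral_cong)
    from this[OF \<nu>_def[symmetric] m0] this[OF initial_law_path_law[OF K \<nu>] m0'] show ?case by simp
  next
    case (Suc n)
    note [measurable] = Suc.prems
    let ?g = "\<lambda>x. indicator (C (Suc n)) x * g x"
    have g': "?g \<in> borel_measurable borel" by measurable
    show ?case
      unfolding split markov_propertyD[OF mM that(1) g'] markov_propertyD[OF mP that(1) g']
      by (rule Suc.IH) (rule kernel_nn_integral_measurable[OF K g'])
  qed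
  have "M = ?P"
  proof (rule measure_eqI_PiM_infinite[OF sM sP])
    show "finite_measure M" using M by (rule prob_space.finite_measure)
    fix A :: "nat \<Rightarrow> 'a set" and J :: "nat set"
    assume J: "finite J" "J \<subseteq> UNIV" and A: "\<And>i. i \<in> J \<Longrightarrow> A i \<in> sets borel"
    obtain n where n: "J \<subseteq> {..n}" using finite_nat_iff_bounded_le J by blast
    define C where "C i = (if i \<in> J then A i else UNIV)" for i
    have C[measurable]: "C i \<in> sets borel" for i using A by (simp add: C_def)
    have emb: "prod_emb UNIV (\<lambda>_. borel) J (Pi\<^sub>E J A) = {\<omega>. \<forall>i\<le>n. \<omega> i \<in> C i}"
      using n by (auto simp: prod_emb_def C_def PiE_iff subset_iff)
    have "{\<omega>. \<forall>i\<le>n. \<omega> i \<in> C i} \<in> sets M" "{\<omega>. \<forall>i\<le>n. \<omega> i \<in> C i} \<in> sets ?P"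
      unfolding sM sP by (rule cylinder_in_sets[OF C])+
    then show "emeasure M (prod_emb UNIV (\<lambda>_. borel) J (Pi\<^sub>E J A)) = emeasure ?P (prod_emb UNIV (\<lambda>_. borel) J (Pi\<^sub>E J A))"
      unfolding emb using eq[of C "\<lambda>_. 1" n, OF C] by simp
  qed
  then show ?thesis by (simp add: \<nu>_def)
qed

lemma shift_measurable: "(\<lambda>\<omega> n. \<omega> (n + k)) \<in> path_space \<rightarrow>\<^sub>M path_space"
  by (rule measurable_PiM_single') (auto simp: space_PiM)

text \<open>A condition of product form on the first two coordinates only prepends one side to a cylinder of
  the shifted path and shrinks the next one, so the conditioned and shifted law inherits the Markov
  property and is identified by its initial law. With \<open>D = F = UNIV\<close> this yields stationarity, with
  \<open>D = - A\<close> and \<open>F = A\<close> the law of a cycle.\<close>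

lemma shift_conditioned_path_law:
  fixes K :: "'a::topological_space \<Rightarrow> 'a measure"
  assumes K: "K \<in> borel \<rightarrow>\<^sub>M prob_algebra borel" and \<nu>: "\<nu> \<in> space (prob_algebra borel)"
    and D[measurable]: "D \<in> sets borel" and F[measurable]: "F \<in> sets borel"
  defines "E \<equiv> {\<omega>. \<omega> 0 \<in> D \<and> \<omega> 1 \<in> F}"
  assumes pos: "0 < measure (path_law K \<nu>) E"
  shows "distr (uniform_measure (path_law K \<nu>) E) path_space (\<lambda>\<omega> n. \<omega> (n + 1))
    = path_law K (distr (uniform_measure (path_law K \<nu>) E) borel (\<lambda>\<omega>. \<omega> 1))"
proof -
  let ?P = "path_law K \<nu>" and ?s = "\<lambda>(\<omega>::nat \<Rightarrow> 'a) n. \<omega> (n + 1)"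
  interpret P: prob_space ?P by (rule prob_space_path_law[OF K \<nu>])
  have sP[measurable_cong]: "sets ?P = sets path_space" by (rule sets_path_law[OF K \<nu>])
  have sU[measurable_cong]: "sets (uniform_measure ?P E) = sets path_space" by (simp add: sP)
  have "Measurable.pred path_space (\<lambda>\<omega>. \<omega> 0 \<in> D \<and> \<omega> 1 \<in> F)" by measurable
  then have E[measurable]: "E \<in> sets path_space" by (simp add: E_def pred_def space_path_space)
  have s: "?s \<in> uniform_measure ?P E \<rightarrow>\<^sub>M path_space"
    by (simp add: measurable_cong_sets[OF sU refl] shift_measurable[of 1, simplified])
  let ?M = "distr (uniform_measure ?P E) path_space ?s"
  have posE: "emeasure ?P E \<noteq> 0" "emeasure ?P E \<noteq> \<infinity>"
    using pos by (auto simp: P.emeasure_eq_measure)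
  have pU: "prob_space (uniform_measure ?P E)" by (rule prob_space_uniform_measure[OF posE])
  have pM: "prob_space ?M" by (rule prob_space.prob_space_distr[OF pU s])
  have int: "(\<integral>\<^sup>+\<omega>. f \<omega> \<partial>?M) = (\<integral>\<^sup>+\<omega>. indicator E \<omega> * f (?s \<omega>) \<partial>?P) / emeasure ?P E"
    if f: "f \<in> borel_measurable path_space" for f
  proof -
    have fs: "(\<lambda>\<omega>. f (?s \<omega>)) \<in> borel_measurable ?P"
      unfolding measurable_cong_sets[OF sP refl] by (rule measurable_compose[OF shift_measurable f])
    have "(\<integral>\<^sup>+\<omega>. f \<omega> \<partial>?M) = (\<integral>\<^sup>+\<omega>. f (?s \<omega>) \<partial>uniform_measure ?P E)"
      by (rule nn_integral_distr[OF s]) (simp add: f)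
    also have "\<dots> = (\<integral>\<^sup>+\<omega>. f (?s \<omega>) * indicator E \<omega> \<partial>?P) / emeasure ?P E"
      by (rule nn_integral_uniform_measure[OF fs]) (simp add: sP)
    finally show ?thesis by (simp only: mult.commute)
  qed
  have mM: "markov_property K ?M"
    unfolding markov_property_def
  proof (rule allI, rule allI, rule ballI, rule impI)
    fix n :: nat and C :: "nat \<Rightarrow> 'a set" and g :: "'a \<Rightarrow> ennreal"
    assume g[measurable]: "g \<in> borel_measurable borel" and "\<forall>i. C i \<in> sets borel"
    then have C[measurable]: "C i \<in> sets borel" for i by blast
    note Kg[measurable] = kernel_nn_integral_measurable[OF K g]
    \<comment> \<open>the cylinder that the shifted path defines for the original path, intersected with \<open>E\<close>\<close>
    define C' where "C' i = (case i of 0 \<Rightarrow> D | Suc j \<Rightarrow> C j \<inter> (if j = 0 then F else UNIV))" for i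
    have C': "C' i \<in> sets borel" for i unfolding C'_def by (auto simp: D F C split: nat.split)
    have "(\<forall>i\<le>Suc n. \<omega> i \<in> C' i) \<longleftrightarrow> \<omega> 0 \<in> C' 0 \<and> (\<forall>i\<le>n. \<omega> (Suc i) \<in> C' (Suc i))" for \<omega>
      by (simp only: less_Suc_eq_le[symmetric] All_less_Suc2)
    moreover have "(\<forall>i\<le>n. \<omega> (Suc i) \<in> C' (Suc i)) \<longleftrightarrow> \<omega> 1 \<in> F \<and> (\<forall>i\<le>n. \<omega> (Suc i) \<in> C i)" for \<omega>
      unfolding C'_def by (auto split: if_splits)
    ultimately have "(\<forall>i\<le>Suc n. \<omega> i \<in> C' i) \<longleftrightarrow> \<omega> \<in> E \<and> (\<forall>i\<le>n. ?s \<omega> i \<in> C i)" for \<omega>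
      by (simp add: C'_def E_def)
    then have ind: "indicator {\<omega>. \<forall>i\<le>Suc n. \<omega> i \<in> C' i} \<omega> = (indicator E \<omega> * indicator {\<omega>. \<forall>i\<le>n. \<omega> i \<in> C i} (?s \<omega>) :: ennreal)" for \<omega>
      by (simp add: indicator_def)
    show "(\<integral>\<^sup>+\<omega>. indicator {\<omega>. \<forall>i\<le>n. \<omega> i \<in> C i} \<omega> * g (\<omega> (Suc n)) \<partial>?M) =
        (\<integral>\<^sup>+\<omega>. indicator {\<omega>. \<forall>i\<le>n. \<omega> i \<in> C i} \<omega> * (\<integral>\<^sup>+y. g y \<partial>K (\<omega> n)) \<partial>?M)"
    proof (subst (1 2) int)
      have "(\<lambda>\<omega>. \<omega> i) \<in> path_space \<rightarrow>\<^sub>M borel" for i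
        by simp
      note meas = measurable_compose[OF this g] measurable_compose[OF this Kg] cylinder_in_sets[OF C]
      show "(\<lambda>\<omega>. indicator {\<omega>. \<forall>i\<le>n. \<omega> i \<in> C i} \<omega> * g (\<omega> (Suc n))) \<in> borel_measurable path_space"
        "(\<lambda>\<omega>. indicator {\<omega>. \<forall>i\<le>n. \<omega> i \<in> C i} \<omega> * (\<integral>\<^sup>+y. g y \<partial>K (\<omega> n))) \<in> borel_measurable path_space"
        by (intro borel_measurable_times_ennreal borel_measurable_indicator; fact)+
      have "(\<integral>\<^sup>+\<omega>. indicator E \<omega> * (indicator {\<omega>. \<forall>i\<le>n. \<omega> i \<in> C i} (?s \<omega>) * g (?s \<omega> (Suc n))) \<partial>?P)
        = (\<integral>\<^sup>+\<omega>. indicator E \<omega> * (indicator {\<omega>. \<forall>i\<le>n. \<omega> i \<in> C i} (?s \<omega>) * (\<integral>\<^sup>+y. g y \<partial>K (?s \<omega> n))) \<partial>?P)"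
        using markov_propertyD[where C=C' and n="Suc n", OF markov_property_path_law[OF K \<nu>] C' g]
        unfolding ind mult.assoc by simp
      then show "(\<integral>\<^sup>+\<omega>. indicator E \<omega> * (indicator {\<omega>. \<forall>i\<le>n. \<omega> i \<in> C i} (?s \<omega>) * g (?s \<omega> (Suc n))) \<partial>?P) / emeasure ?P E
        = (\<integral>\<^sup>+\<omega>. indicator E \<omega> * (indicator {\<omega>. \<forall>i\<le>n. \<omega> i \<in> C i} (?s \<omega>) * (\<integral>\<^sup>+y. g y \<partial>K (?s \<omega> n))) \<partial>?P) / emeasure ?P E"
        by simp
    qed
  qed
  have "?M = path_law K (distr ?M borel (\<lambda>\<omega>. \<omega> 0))"
    by (rule path_law_eqI[OF K _ pM mM]) simp
  also have "distr ?M borel (\<lambda>\<omega>. \<omega> 0) = distr (uniform_measure ?P E) borel (\<lambda>\<omega>. \<omega> 1)"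
    by (subst distr_distr[OF _ s]) (auto simp: comp_def)
  finally show ?thesis .
qed

section \<open>Stationary chains\<close>

lemma emeasure_path_law_step:
  fixes K :: "'a::topological_space \<Rightarrow> 'a measure"
  assumes K: "K \<in> borel \<rightarrow>\<^sub>M prob_algebra borel" and \<nu>: "\<nu> \<in> space (prob_algebra borel)"
    and D: "D \<in> sets borel" and S: "S \<in> sets borel"
  shows "emeasure (path_law K \<nu>) {\<omega>. \<omega> n \<in> D \<and> \<omega> (Suc n) \<in> S}
    = (\<integral>\<^sup>+\<omega>. indicator D (\<omega> n) * emeasure (K (\<omega> n)) S \<partial>path_law K \<nu>)"
proof -
  let ?C = "\<lambda>i. if i = n then D else UNIV"
  have sP: "sets (path_law K \<nu>) = sets path_space" by (rule sets_path_law[OF K \<nu>])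
  have "Measurable.pred path_space (\<lambda>\<omega>. \<omega> n \<in> D \<and> \<omega> (Suc n) \<in> S)"
    using D S by measurable
  then have m: "{\<omega>. \<omega> n \<in> D \<and> \<omega> (Suc n) \<in> S} \<in> sets (path_law K \<nu>)"
    by (simp add: sP pred_def space_path_space)
  have C: "?C i \<in> sets borel" for i using D by simp
  have cyl: "{\<omega>. \<forall>i\<le>n. \<omega> i \<in> ?C i} = {\<omega>. \<omega> n \<in> D}"
    by auto
  have "emeasure (path_law K \<nu>) {\<omega>. \<omega> n \<in> D \<and> \<omega> (Suc n) \<in> S}
      = (\<integral>\<^sup>+\<omega>. indicator {\<omega>. \<omega> n \<in> D} \<omega> * indicator S (\<omega> (Suc n)) \<partial>path_law K \<nu>)"
    by (subst nn_integral_indicator[OF m, symmetric]) (auto intro!: nn_integral_cong simp: indicator_def)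
  also have "\<dots> = (\<integral>\<^sup>+\<omega>. indicator {\<omega>. \<omega> n \<in> D} \<omega> * (\<integral>\<^sup>+y. indicator S y \<partial>K (\<omega> n)) \<partial>path_law K \<nu>)"
    using markov_propertyD[where C="?C" and n=n and g="indicator S", OF markov_property_path_law[OF K \<nu>] C] S
    unfolding cyl by simp
  also have "\<dots> = (\<integral>\<^sup>+\<omega>. indicator D (\<omega> n) * emeasure (K (\<omega> n)) S \<partial>path_law K \<nu>)"
    using S by (intro nn_integral_cong) (simp add: kernel_sets[OF K] split: split_indicator)
  finally show ?thesis .
qed

lemma nn_integral_path_law_0:
  fixes K :: "'a::topological_space \<Rightarrow> 'a measure"
  assumes K: "K \<in> borel \<rightarrow>\<^sub>M prob_algebra borel" and \<nu>: "\<nu> \<in> space (prob_algebra borel)"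
    and f: "f \<in> borel_measurable borel"
  shows "(\<integral>\<^sup>+\<omega>. f (\<omega> 0) \<partial>path_law K \<nu>) = (\<integral>\<^sup>+x. f x \<partial>\<nu>)"
proof -
  have "(\<lambda>\<omega>. \<omega> 0) \<in> path_law K \<nu> \<rightarrow>\<^sub>M borel"
    by (simp add: measurable_cong_sets[OF sets_path_law[OF K \<nu>] refl])
  then have "(\<integral>\<^sup>+\<omega>. f (\<omega> 0) \<partial>path_law K \<nu>) = (\<integral>\<^sup>+x. f x \<partial>distr (path_law K \<nu>) borel (\<lambda>\<omega>. \<omega> 0))"
    using f by (subst nn_integral_distr) auto
  then show ?thesis
    by (simp add: initial_law_path_law[OF K \<nu>])
qed

locale stationary_chain =
  fixes K :: "'a::topological_space \<Rightarrow> 'a measure" and \<mu> :: "'a measure"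
  assumes K: "K \<in> borel \<rightarrow>\<^sub>M prob_algebra borel"
    and \<mu>: "\<mu> \<in> space (prob_algebra borel)"
    and invariant: "\<mu> \<bind> K = \<mu>"
begin

abbreviation P :: "(nat \<Rightarrow> 'a) measure" where "P \<equiv> path_law K \<mu>"

sublocale \<mu>: prob_space \<mu>
  using \<mu> by (simp add: space_prob_algebra)

sublocale P: prob_space P
  by (rule prob_space_path_law[OF K \<mu>])

lemma sets_\<mu> [measurable_cong]: "sets \<mu> = sets borel"
  using \<mu> by (simp add: space_prob_algebra)

lemma space_\<mu>: "space \<mu> = UNIV"
  using sets_eq_imp_space_eq[OF sets_\<mu>] by simp

lemma sets_P [measurable_cong]: "sets P = sets path_space"
  by (rule sets_path_law[OF K \<mu>])

lemma space_P: "space P = UNIV"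
  using sets_eq_imp_space_eq[OF sets_P] by (simp add: space_path_space)

lemma P_sets:
  assumes "Measurable.pred path_space Q"
  shows "{\<omega>. Q \<omega>} \<in> sets P"
  using assms by (simp add: pred_def space_path_space sets_P)

lemma invariant_nn_integral:
  assumes "S \<in> sets borel"
  shows "(\<integral>\<^sup>+x. emeasure (K x) S \<partial>\<mu>) = emeasure \<mu> S"
proof -
  have "emeasure (\<mu> \<bind> K) S = (\<integral>\<^sup>+x. emeasure (K x) S \<partial>\<mu>)"
    using measurable_prob_algebraD[OF K] assms
    by (intro emeasure_bind[where N=borel]) (auto simp: space_\<mu> cong: measurable_cong_sets)
  then show ?thesis by (simp add: invariant)
qed

lemma stationary: "distr P path_space (\<lambda>\<omega> n. \<omega> (n + k)) = P"
proof (induction k)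
  case 0
  show ?case by (simp add: distr_id2[OF sets_P[symmetric]])
next
  case (Suc k)
  have U: "{\<omega>. \<omega> 0 \<in> (UNIV :: 'a set) \<and> \<omega> 1 \<in> (UNIV :: 'a set)} = space P"
    by (simp add: space_P)
  have um: "uniform_measure P {\<omega>. \<omega> 0 \<in> (UNIV :: 'a set) \<and> \<omega> 1 \<in> (UNIV :: 'a set)} = P"
    unfolding U by (rule measure_eqI) (auto simp: P.emeasure_space_1 sets.Int_space_eq1 divide_ennreal_def)
  have "emeasure (distr P borel (\<lambda>\<omega>. \<omega> 1)) S = emeasure \<mu> S" if S: "S \<in> sets borel" for S
  proof -
    have "emeasure (distr P borel (\<lambda>\<omega>. \<omega> 1)) S = emeasure P {\<omega>. \<omega> 0 \<in> UNIV \<and> \<omega> (Suc 0) \<in> S}"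
      using S by (subst emeasure_distr) (auto simp: space_P intro!: arg_cong2[where f=emeasure])
    also have "\<dots> = (\<integral>\<^sup>+\<omega>. emeasure (K (\<omega> 0)) S \<partial>P)"
      by (subst emeasure_path_law_step[OF K \<mu> _ S]) auto
    also have "\<dots> = emeasure \<mu> S"
      by (simp add: nn_integral_path_law_0[OF K \<mu> kernel_emeasure_measurable[OF K S]] invariant_nn_integral[OF S])
    finally show ?thesis .
  qed
  then have "distr P borel (\<lambda>\<omega>. \<omega> 1) = \<mu>"
    by (intro measure_eqI) (auto simp: sets_\<mu>)
  then have one: "distr P path_space (\<lambda>\<omega> n. \<omega> (n + 1)) = P"
    using shift_conditioned_path_law[OF K \<mu>, of UNIV UNIV] unfolding um using P.prob_space by (simp add: U space_P)
  have "distr P path_space (\<lambda>\<omega> n. \<omega> (n + Suc k))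
      = distr (distr P path_space (\<lambda>\<omega> n. \<omega> (n + k))) path_space (\<lambda>\<omega> n. \<omega> (n + 1))"
    by (subst distr_distr[OF shift_measurable]) (auto simp: comp_def measurable_cong_sets[OF sets_P refl] shift_measurable)
  then show ?case by (simp only: Suc one)
qed

lemma measure_shift:
  assumes "Measurable.pred path_space Q"
  shows "measure P {\<omega>. Q (\<lambda>n. \<omega> (n + k))} = measure P {\<omega>. Q \<omega>}"
proof -
  have "measure P {\<omega>. Q \<omega>} = measure (distr P path_space (\<lambda>\<omega> n. \<omega> (n + k))) {\<omega>. Q \<omega>}"
    by (simp add: stationary)
  also have "\<dots> = measure P {\<omega>. Q (\<lambda>n. \<omega> (n + k))}"
    using P_sets[OF assms]
    by (subst measure_distr) (auto simp: measurable_cong_sets[OF sets_P refl] shift_measurable sets_P space_P intro!: arg_cong2[where f=measure])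
  finally show ?thesis ..
qed

lemma measure_at:
  assumes S: "S \<in> sets borel"
  shows "measure P {\<omega>. \<omega> n \<in> S} = measure \<mu> S"
proof -
  have "measure P {\<omega>. \<omega> n \<in> S} = measure P {\<omega>. \<omega> 0 \<in> S}"
    using measure_shift[of "\<lambda>\<omega>. \<omega> 0 \<in> S" n] S by simp
  also have "\<dots> = measure (distr P borel (\<lambda>\<omega>. \<omega> 0)) S"
    using S by (subst measure_distr) (auto simp: space_P intro!: arg_cong2[where f=measure])
  finally show ?thesis by (simp add: initial_law_path_law[OF K \<mu>])
qed

text \<open>Leaving \<open>C\<close> has probability \<open>0\<close> only from almost every point of \<open>C\<close>, so the exceptional points are
  removed. From the remaining set the chain might step to a removed point, and the removal is
  iterated. Invariance of \<open>\<mu>\<close> keeps each step null: a \<open>\<mu>\<close>-null set is hit in one step with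
  probability \<open>0\<close> from \<open>\<mu>\<close>-almost every point.\<close>

lemma ex_closed_subset:
  assumes C[measurable]: "C \<in> sets borel"
    and ae: "AE x in \<mu>. x \<in> C \<longrightarrow> emeasure (K x) (- C) = 0"
  shows "\<exists>D\<subseteq>C. D \<in> sets borel \<and> measure \<mu> D = measure \<mu> C \<and> (\<forall>x\<in>D. emeasure (K x) (- D) = 0)"
proof -
  note Km[measurable] = kernel_emeasure_measurable[OF K]
  define S where "S = rec_nat C (\<lambda>_ T. {x \<in> T. emeasure (K x) (- T) = 0})"
  have S0: "S 0 = C" and SS: "S (Suc n) = {x \<in> S n. emeasure (K x) (- S n) = 0}" for n
    by (simp_all add: S_def)
  have S[measurable]: "S n \<in> sets borel" for n
  proof (induction n)
    case (Suc n)
    note [measurable] = Suc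
    have "- S n \<in> sets borel" using Suc by simp
    note [measurable] = Km[OF this]
    have "Measurable.pred borel (\<lambda>x. x \<in> S n \<and> emeasure (K x) (- S n) = 0)" by measurable
    then show ?case by (simp add: SS pred_def)
  qed (simp add: S0 C)
  have sub: "S n \<subseteq> C" for n
    by (induction n) (auto simp: S0 SS)
  have AES: "AE x in \<mu>. x \<in> C \<longrightarrow> x \<in> S n" for n
  proof (induction n)
    case (Suc n)
    have m: "C - S n \<in> sets borel" by measurable
    have "emeasure \<mu> (C - S n) = 0"
      using Suc by (subst (asm) AE_iff_measurable[where N="C - S n"]) (auto simp: space_\<mu> sets_\<mu>)
    then have "(\<integral>\<^sup>+x. emeasure (K x) (C - S n) \<partial>\<mu>) = 0"
      by (simp add: invariant_nn_integral[OF m])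
    then have "AE x in \<mu>. emeasure (K x) (C - S n) = 0"
      using Km[OF m] by (subst (asm) nn_integral_0_iff_AE) (auto cong: measurable_cong_sets simp: sets_\<mu>)
    with ae Suc show ?case
    proof eventually_elim
      case (elim x)
      have "emeasure (K x) (- S n) \<le> emeasure (K x) (- C) + emeasure (K x) (C - S n)"
        using m sub[of n] by (subst emeasure_subadditive[THEN order_trans[rotated]])
          (auto simp: kernel_sets[OF K] intro!: emeasure_mono)
      with elim show ?case by (auto simp: SS)
    qed
  qed (simp add: S0)
  \<comment> \<open>a point in all the sets steps into each of them almost surely, hence into the intersection\<close>
  let ?D = "\<Inter>n. S n"
  have D: "?D \<in> sets borel" by measurable
  have "AE x in \<mu>. \<forall>n. x \<in> C \<longrightarrow> x \<in> S n"
    unfolding AE_all_countable using AES by blast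
  then have "measure \<mu> ?D = measure \<mu> C"
  proof (intro measure_eq_AE)
    assume "AE x in \<mu>. \<forall>n. x \<in> C \<longrightarrow> x \<in> S n"
    then show "AE x in \<mu>. x \<in> ?D \<longleftrightarrow> x \<in> C"
      by eventually_elim (use sub in blast)
  qed (use D in \<open>auto simp: sets_\<mu>\<close>)
  moreover have "emeasure (K x) (- ?D) = 0" if "x \<in> ?D" for x
  proof -
    have "x \<in> S (Suc n)" for n using that by blast
    then have "emeasure (K x) (- S n) = 0" for n by (simp add: SS)
    then have "emeasure (K x) (\<Union>n. - S n) = 0"
      by (intro emeasure_UN_eq_0) (auto simp: kernel_sets[OF K])
    then show ?thesis by (simp add: Compl_INT)
  qed
  moreover have "?D \<subseteq> C" using sub by blast
  ultimately show ?thesis using D by blast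
qed

end

section \<open>Positivity of the cycle rate\<close>

lemma AE_path_law_closed:
  fixes K :: "'a::topological_space \<Rightarrow> 'a measure"
  assumes K: "K \<in> borel \<rightarrow>\<^sub>M prob_algebra borel"
    and D[measurable]: "D \<in> sets borel" and closed: "\<And>y. y \<in> D \<Longrightarrow> emeasure (K y) (- D) = 0"
    and x: "x \<in> D"
  shows "AE \<omega> in path_law K (return borel x). \<forall>n. \<omega> n \<in> D"
proof -
  have r: "return borel x \<in> space (prob_algebra borel)"
    by (simp add: space_prob_algebra prob_space_return)
  let ?P = "path_law K (return borel x)"
  have sP[measurable_cong]: "sets ?P = sets path_space" by (rule sets_path_law[OF K r])
  have spP: "space ?P = UNIV"
    using sets_eq_imp_space_eq[OF sP] by (simp add: space_path_space)
  have "AE \<omega> in ?P. \<omega> n \<in> D" for n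
  proof (induction n)
    case 0
    have "AE y in distr ?P borel (\<lambda>\<omega>. \<omega> 0). y \<in> D"
      unfolding initial_law_path_law[OF K r] using x by (subst AE_return) auto
    then show ?case by (subst (asm) AE_distr_iff) auto
  next
    case (Suc n)
    have "emeasure ?P {\<omega>. \<omega> n \<in> D \<and> \<omega> (Suc n) \<in> - D} = 0"
      using closed by (subst emeasure_path_law_step[OF K r]) (auto simp: nn_integral_0_iff_AE indicator_def intro!: nn_integral_zero')
    moreover have "Measurable.pred path_space (\<lambda>\<omega>. \<omega> n \<in> D \<and> \<omega> (Suc n) \<in> - D)" by measurable
    ultimately have "AE \<omega> in ?P. \<not> (\<omega> n \<in> D \<and> \<omega> (Suc n) \<in> - D)"
      by (subst AE_iff_measurable) (auto simp: spP pred_def space_path_space sP)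
    with Suc show ?case by eventually_elim auto
  qed
  then show ?thesis by (simp add: AE_all_countable)
qed

lemma positive_harris_stationary: "positive_harris_chain K \<mu> \<Longrightarrow> stationary_chain K \<mu>"
  unfolding positive_harris_chain_def by unfold_locales (auto simp: space_prob_algebra)

text \<open>Stationarity balances the flows into and out of \<open>A\<close>, so a vanishing cycle rate would make both \<open>A\<close>
  and its complement traps: each contains a starting point from which it is almost surely never left.
  Then the measure in the definition of Harris recurrence charges neither of them.\<close>

lemma cycle_rate_pos:
  fixes K :: "'a::topological_space \<Rightarrow> 'a measure"
  assumes chain: "positive_harris_chain K \<mu>" and A[measurable]: "A \<in> sets borel"
    and \<mu>A: "0 < measure \<mu> A" "measure \<mu> A < 1"
  shows "0 < cycle_rate K \<mu> A"
proof (rule ccontr)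
  interpret stationary_chain K \<mu> by (rule positive_harris_stationary[OF chain])
  assume "\<not> 0 < cycle_rate K \<mu> A"
  then have "measure P {\<omega>. \<omega> 0 \<notin> A \<and> \<omega> 1 \<in> A} = 0"
    by (simp add: cycle_rate_def not_less measure_le_0_iff)
  then have in0: "measure P {\<omega>. \<omega> 0 \<in> - A \<and> \<omega> (Suc 0) \<in> - (- A)} = 0"
    by simp
  have out0: "measure P {\<omega>. \<omega> 0 \<in> A \<and> \<omega> (Suc 0) \<in> - A} = 0"
  proof -
    have s: "{\<omega>. \<omega> 0 \<in> A \<and> \<omega> (Suc 0) \<in> - A} \<in> sets P" "{\<omega>. \<omega> 0 \<in> - A \<and> \<omega> (Suc 0) \<in> A} \<in> sets P"
      "{\<omega>. \<omega> 0 \<in> A \<and> \<omega> (Suc 0) \<in> A} \<in> sets P"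
      by (intro P_sets; measurable)+
    have "measure P {\<omega>. \<omega> 0 \<in> A} = measure P {\<omega>. \<omega> 0 \<in> A \<and> \<omega> (Suc 0) \<in> A} + measure P {\<omega>. \<omega> 0 \<in> A \<and> \<omega> (Suc 0) \<in> - A}"
      using s by (subst P.finite_measure_Union[symmetric]) (auto intro!: arg_cong2[where f=measure])
    moreover have "measure P {\<omega>. \<omega> (Suc 0) \<in> A} = measure P {\<omega>. \<omega> 0 \<in> A \<and> \<omega> (Suc 0) \<in> A} + measure P {\<omega>. \<omega> 0 \<in> - A \<and> \<omega> (Suc 0) \<in> A}"
      using s by (subst P.finite_measure_Union[symmetric]) (auto intro!: arg_cong2[where f=measure])
    ultimately show ?thesis using in0 measure_at[OF A] by simp
  qed
  \<comment> \<open>a set of positive measure that is almost surely not left in one step contains a trap\<close>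
  have trapped: "\<exists>x. AE \<omega> in path_law K (return borel x). \<forall>n. \<omega> n \<in> C"
    if C[measurable]: "C \<in> sets borel" and "0 < measure \<mu> C"
      and no: "measure P {\<omega>. \<omega> 0 \<in> C \<and> \<omega> (Suc 0) \<in> - C} = 0" for C
  proof -
    have Cc: "- C \<in> sets borel" by simp
    note Km[measurable] = kernel_emeasure_measurable[OF K Cc]
    have "(\<integral>\<^sup>+x. indicator C x * emeasure (K x) (- C) \<partial>\<mu>) = emeasure P {\<omega>. \<omega> 0 \<in> C \<and> \<omega> (Suc 0) \<in> - C}"
      unfolding emeasure_path_law_step[OF K \<mu> C Cc] by (subst nn_integral_path_law_0[OF K \<mu>]) auto
    also have "\<dots> = 0" using no by (simp add: P.emeasure_eq_measure)
    finally have "AE x in \<mu>. indicator C x * emeasure (K x) (- C) = 0"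
      by (subst (asm) nn_integral_0_iff_AE) auto
    then have "AE x in \<mu>. x \<in> C \<longrightarrow> emeasure (K x) (- C) = 0"
      by eventually_elim (auto simp: indicator_def)
    from ex_closed_subset[OF C this] obtain D where D: "D \<subseteq> C" "D \<in> sets borel"
      "measure \<mu> D = measure \<mu> C" "\<And>x. x \<in> D \<Longrightarrow> emeasure (K x) (- D) = 0" by blast
    from D(3) \<open>0 < measure \<mu> C\<close> have "D \<noteq> {}" by auto
    then obtain x where "x \<in> D" by blast
    have "AE \<omega> in path_law K (return borel x). \<forall>n. \<omega> n \<in> D"
      by (rule AE_path_law_closed[OF K D(2) D(4) \<open>x \<in> D\<close>])
    then have "AE \<omega> in path_law K (return borel x). \<forall>n. \<omega> n \<in> C"
      by eventually_elim (use D(1) in blast)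
    then show ?thesis by blast
  qed
  have pos: "0 < measure \<mu> (- A)"
    using \<mu>.prob_compl[of A] \<mu>A by (simp add: space_\<mu> sets_\<mu> Compl_eq_Diff_UNIV)
  obtain \<phi> where \<phi>: "sets \<phi> = sets borel" "emeasure \<phi> UNIV \<noteq> 0"
    and rec: "\<And>C x. C \<in> sets borel \<Longrightarrow> emeasure \<phi> C \<noteq> 0 \<Longrightarrow> AE \<omega> in path_law K (return borel x). \<exists>\<^sub>\<infinity>n. \<omega> n \<in> C"
    using chain unfolding positive_harris_chain_def harris_recurrent_def by blast
  have null: "emeasure \<phi> C = 0" if C: "C \<in> sets borel" and tr: "\<exists>x. AE \<omega> in path_law K (return borel x). \<forall>n. \<omega> n \<in> - C" for C
  proof (rule ccontr)
    assume ne: "emeasure \<phi> C \<noteq> 0"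
    obtain x where "AE \<omega> in path_law K (return borel x). \<forall>n. \<omega> n \<in> - C" using tr by blast
    with rec[OF C ne, of x] have "AE \<omega> in path_law K (return borel x). False"
      by eventually_elim (auto dest: INFM_EX)
    moreover have "prob_space (path_law K (return borel x))"
      by (rule prob_space_path_law[OF K]) (simp add: space_prob_algebra prob_space_return)
    ultimately show False by (simp add: prob_space.AE_False)
  qed
  have "emeasure \<phi> A = 0" "emeasure \<phi> (- A) = 0"
    using null[of A] null[of "- A"] trapped[OF A \<mu>A(1) out0] trapped[OF _ pos in0] by auto
  then have "emeasure \<phi> (A \<union> - A) \<le> 0"
    using \<phi> by (intro order_trans[OF emeasure_subadditive]) auto
  then show False using \<phi>(2) by simp
qed

section \<open>The cycle inequality\<close>

lemma less_first_time_iff: "enat n < first_time Q \<longleftrightarrow> (\<forall>k. Q k \<longrightarrow> n < k)"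
  by (simp add: first_time_def Suc_ile_eq[symmetric] le_INF_iff Suc_le_eq)

text \<open>An inequality, since \<open>card\<close> is \<open>0\<close> on infinite sets.\<close>

lemma of_card_le_suminf_indicator: "ennreal (real (card S)) \<le> (\<Sum>n. indicator S n)"
proof (cases "finite S")
  case True
  then have "ennreal (real (card S)) = (\<Sum>n\<in>S. indicator S n)"
    by (simp add: ennreal_of_nat_eq_real_of_nat)
  also have "\<dots> \<le> (\<Sum>n. indicator S n)"
    by (intro sum_le_suminf True) auto
  finally show ?thesis .
qed simp

lemma ennreal_integral_le_nn_integral:
  assumes "\<And>x. 0 \<le> f x"
  shows "ennreal (\<integral>x. f x \<partial>M) \<le> (\<integral>\<^sup>+x. ennreal (f x) \<partial>M)"
  by (cases "integrable M f") (auto simp: nn_integral_eq_integral assms not_integrable_integral_eq)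

context stationary_chain
begin

lemma cycle_law_eq_shift_conditioned:
  assumes A: "A \<in> sets borel" and pos: "0 < cycle_rate K \<mu> A"
  shows "cycle_law K \<mu> A =
    distr (uniform_measure P {\<omega>. \<omega> 0 \<notin> A \<and> \<omega> 1 \<in> A}) path_space (\<lambda>\<omega> n. \<omega> (n + 1))"
  using shift_conditioned_path_law[OF K \<mu>, of "- A" A] A pos
  by (simp add: cycle_law_def cycle_origin_def cycle_rate_def)

lemma prob_space_cycle_law:
  assumes A: "A \<in> sets borel" and pos: "0 < cycle_rate K \<mu> A"
  shows "prob_space (cycle_law K \<mu> A)"
  unfolding cycle_law_eq_shift_conditioned[OF assms]
proof (rule prob_space.prob_space_distr)
  show "prob_space (uniform_measure P {\<omega>. \<omega> 0 \<notin> A \<and> \<omega> 1 \<in> A})"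
    using pos by (intro prob_space_uniform_measure) (auto simp: P.emeasure_eq_measure cycle_rate_def)
  show "(\<lambda>\<omega> n. \<omega> (n + 1)) \<in> uniform_measure P {\<omega>. \<omega> 0 \<notin> A \<and> \<omega> 1 \<in> A} \<rightarrow>\<^sub>M path_space"
    using shift_measurable[of 1] by (subst measurable_cong_sets[OF _ refl]) (simp_all add: sets_P)
qed

text \<open>One half of the cycle formula \<open>\<mu> B = \<alpha> * T\<^sub>B\<close>. A visit to \<open>B\<close> at the \<open>n\<close>-th step of a cycle is, for
  the stationary chain, an entry to \<open>A\<close> followed after \<open>n\<close> steps by a visit to \<open>B\<close> without a new
  entry in between. Moving the visits for all \<open>n < N\<close> to the common time \<open>N\<close> makes these events
  disjoint, as the last entry to \<open>A\<close> is then at time \<open>N - n\<close>.\<close>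

lemma cycle_rate_mean_visits_le:
  assumes A[measurable]: "A \<in> sets borel" and B[measurable]: "B \<in> sets borel"
    and pos: "0 < cycle_rate K \<mu> A"
  shows "cycle_rate K \<mu> A * mean_visits K \<mu> A B \<le> measure \<mu> B"
proof -
  let ?\<alpha> = "cycle_rate K \<mu> A" and ?Q = "cycle_law K \<mu> A"
  define E where "E = {\<omega> :: nat \<Rightarrow> 'a. \<omega> 0 \<notin> A \<and> \<omega> 1 \<in> A}"
  define V where "V n = {\<omega>. enat n < entry_time A \<omega> \<and> \<omega> n \<in> B}" for n :: nat
  \<comment> \<open>\<open>V n\<close> as an event for the path that makes its entry to \<open>A\<close> between times \<open>0\<close> and \<open>1\<close>\<close>
  define u where "u n \<omega> \<longleftrightarrow> \<omega> 0 \<notin> A \<and> \<omega> (Suc 0) \<in> A \<and> (\<forall>j. 0 < j \<longrightarrow> \<omega> j \<notin> A \<and> \<omega> (Suc j) \<in> A \<longrightarrow> n < j)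
    \<and> \<omega> (Suc n) \<in> B" for n and \<omega> :: "nat \<Rightarrow> 'a"
  have u_meas: "Measurable.pred path_space (u n)" for n
    unfolding u_def[abs_def] by measurable
  have V_iff: "\<omega> \<in> V n \<longleftrightarrow> (\<forall>j. 0 < j \<and> \<omega> (j - 1) \<notin> A \<and> \<omega> j \<in> A \<longrightarrow> n < j) \<and> \<omega> n \<in> B" for n \<omega>
    by (simp add: V_def entry_time_def less_first_time_iff)
  have "Measurable.pred path_space (\<lambda>\<omega>. \<omega> \<in> V n)" for n
    unfolding V_iff by measurable
  then have V_sets: "V n \<in> sets path_space" for n
    by (simp add: pred_def space_path_space)
  have EV: "{\<omega>::nat \<Rightarrow> 'a. \<omega> \<in> E \<and> (\<lambda>n. \<omega> (n + 1)) \<in> V n} = {\<omega>. u n \<omega>}" for n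
    unfolding V_iff E_def u_def by (auto simp: gr0_conv_Suc)
  have Epos: "measure P E = ?\<alpha>" by (simp add: E_def cycle_rate_def)
  have "Measurable.pred path_space (\<lambda>\<omega>. \<omega> 0 \<notin> A \<and> \<omega> 1 \<in> A)" by measurable
  then have E_sets: "E \<in> sets P" unfolding E_def by (rule P_sets)
  have sQ: "sets ?Q = sets path_space"
    by (simp add: cycle_law_eq_shift_conditioned[OF A pos])
  have QV: "emeasure ?Q (V n) = ennreal (measure P {\<omega>. u n \<omega>} / ?\<alpha>)" for n
  proof -
    have sm: "(\<lambda>\<omega> n. \<omega> (n + 1)) \<in> uniform_measure P E \<rightarrow>\<^sub>M path_space"
      using shift_measurable[of 1] by (subst measurable_cong_sets[OF _ refl]) (simp_all add: sets_P)
    have pre: "(\<lambda>\<omega> n. \<omega> (n + 1)) -` V n \<inter> space (uniform_measure P E) \<in> sets P"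
      using measurable_sets[OF sm V_sets] by simp
    have "emeasure ?Q (V n) = emeasure (uniform_measure P E) ((\<lambda>\<omega> n. \<omega> (n + 1)) -` V n \<inter> space (uniform_measure P E))"
      unfolding cycle_law_eq_shift_conditioned[OF A pos] E_def[symmetric]
      by (rule emeasure_distr[OF sm V_sets])
    also have "\<dots> = emeasure P (E \<inter> ((\<lambda>\<omega> n. \<omega> (n + 1)) -` V n \<inter> space (uniform_measure P E))) / emeasure P E"
      by (rule emeasure_uniform_measure[OF E_sets pre])
    also have "E \<inter> ((\<lambda>\<omega> n. \<omega> (n + 1)) -` V n \<inter> space (uniform_measure P E)) = {\<omega>. u n \<omega>}"
      unfolding EV[symmetric] by (auto simp: space_P)
    finally show ?thesis
      using pos by (simp add: P.emeasure_eq_measure Epos divide_ennreal)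
  qed
  have partial: "(\<Sum>n<N. measure P {\<omega>. u n \<omega>}) \<le> measure \<mu> B" for N
  proof -
    \<comment> \<open>the shift puts the visit to \<open>B\<close> at time \<open>N\<close> and the entry to \<open>A\<close> at time \<open>N - n\<close>\<close>
    define W where "W n = {\<omega>. u n (\<lambda>i. \<omega> (i + (N - 1 - n)))}" for n
    have W_sets: "W n \<in> sets P" for n
      unfolding W_def by (intro P_sets measurable_compose[OF shift_measurable u_meas])
    have disj: "W n \<inter> W n' = {}" if "n < n'" "n' < N" for n n'
    proof (rule ccontr)
      assume "W n \<inter> W n' \<noteq> {}"
      then obtain \<omega> where 1: "u n (\<lambda>i. \<omega> (i + (N - 1 - n)))" and 2: "u n' (\<lambda>i. \<omega> (i + (N - 1 - n')))"
        by (auto simp: W_def)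
      \<comment> \<open>the entry prescribed by \<open>W n\<close> comes \<open>n' - n\<close> steps after the one prescribed by \<open>W n'\<close>\<close>
      have "n' - n + (N - 1 - n') = N - 1 - n" using that by auto
      then have "n' < n' - n" using 1 2 that unfolding u_def by (auto dest!: spec[of _ "n' - n"])
      then show False by simp
    qed
    have "(\<Sum>n<N. measure P {\<omega>. u n \<omega>}) = (\<Sum>n<N. measure P (W n))"
      unfolding W_def by (intro sum.cong refl measure_shift[OF u_meas, symmetric])
    also have "\<dots> = measure P (\<Union>n<N. W n)"
    proof (intro P.finite_measure_finite_Union[symmetric])
      show "disjoint_family_on W {..<N}"
        unfolding disjoint_family_on_def
      proof (intro ballI impI)
        fix n n' assume "n \<in> {..<N}" "n' \<in> {..<N}" "n \<noteq> n'"
        then show "W n \<inter> W n' = {}"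
          using disj[of n n'] disj[of n' n] by (cases n n' rule: linorder_cases) auto
      qed
    qed (use W_sets in auto)
    also have "\<dots> \<le> measure P {\<omega>. \<omega> N \<in> B}"
    proof (rule P.finite_measure_mono)
      show "(\<Union>n<N. W n) \<subseteq> {\<omega>. \<omega> N \<in> B}"
        by (auto simp: W_def u_def)
      show "{\<omega>. \<omega> N \<in> B} \<in> P.events"
        by (rule P_sets) measurable
    qed
    finally show ?thesis by (simp add: measure_at[OF B])
  qed
  have "ennreal (mean_visits K \<mu> A B) \<le> (\<integral>\<^sup>+\<omega>. ennreal (real (cycle_visits A B \<omega>)) \<partial>?Q)"
    unfolding mean_visits_def by (rule ennreal_integral_le_nn_integral) simp
  also have "\<dots> \<le> (\<integral>\<^sup>+\<omega>. (\<Sum>n. indicator (V n) \<omega>) \<partial>?Q)"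
  proof (rule nn_integral_mono)
    fix \<omega>
    have "indicator {n. enat n < entry_time A \<omega> \<and> \<omega> n \<in> B} n = (indicator (V n) \<omega> :: ennreal)" for n
      by (simp add: V_def indicator_def)
    then show "ennreal (real (cycle_visits A B \<omega>)) \<le> (\<Sum>n. indicator (V n) \<omega>)"
      using of_card_le_suminf_indicator[of "{n. enat n < entry_time A \<omega> \<and> \<omega> n \<in> B}"]
      by (simp add: cycle_visits_def)
  qed
  also have "\<dots> = (\<Sum>n. emeasure ?Q (V n))"
    using V_sets by (subst nn_integral_suminf) (auto simp: sQ intro!: borel_measurable_indicator)
  also have "\<dots> \<le> ennreal (measure \<mu> B / ?\<alpha>)"
  proof (rule suminf_le_const)
    fix N
    have "(\<Sum>n<N. emeasure ?Q (V n)) = ennreal ((\<Sum>n<N. measure P {\<omega>. u n \<omega>}) / ?\<alpha>)"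
      using pos by (simp add: QV sum_ennreal sum_divide_distrib)
    also have "\<dots> \<le> ennreal (measure \<mu> B / ?\<alpha>)"
      using pos partial[of N] by (intro ennreal_leI divide_right_mono) auto
    finally show "(\<Sum>n<N. emeasure ?Q (V n)) \<le> ennreal (measure \<mu> B / ?\<alpha>)" .
  qed simp
  finally have "mean_visits K \<mu> A B \<le> measure \<mu> B / ?\<alpha>"
    using pos by (subst (asm) ennreal_le_iff) auto
  then show ?thesis
    using pos by (simp add: field_simps)
qed

end

section \<open>Logarithms against powers\<close>

text \<open>With \<open>t = - ln p\<close> the left side is the square of \<open>t * exp (- a * t / 2)\<close>, and
  \<open>a * t / 2 \<le> exp (a * t / 2)\<close>. At \<open>p = 0\<close> both factors are \<open>0\<close> by convention.\<close>

lemma ln_sq_times_powr_le: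
  fixes p a :: real
  assumes "0 \<le> p" "p \<le> 1" "0 < a"
  shows "(ln p)\<^sup>2 * p powr a \<le> (2 / a)\<^sup>2"
proof (cases "p = 0")
  case False
  define t where "t = - ln p"
  have t: "0 \<le> t" and p: "p powr a = (exp (- (a * t / 2)))\<^sup>2"
    using assms False by (auto simp: t_def powr_def exp_double[symmetric] field_simps)
  have "a * t / 2 \<le> exp (a * t / 2)"
    using exp_ge_add_one_self[of "a * t / 2"] by linarith
  then have "t * exp (- (a * t / 2)) \<le> 2 / a"
    using assms by (simp add: exp_minus field_simps)
  then have "(t * exp (- (a * t / 2)))\<^sup>2 \<le> (2 / a)\<^sup>2"
    using t by (intro power_mono) auto
  then show ?thesis
    by (simp add: p t_def power_mult_distrib)
qed simp

text \<open>The power of \<open>p\<close> released by \<open>T powr e = (T * p powr (- \<delta>)) powr e * p powr (\<delta> * e)\<close> compensates the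
  logarithm. Where \<open>p = 0\<close> the logarithm is \<open>0\<close> and only \<open>T powr e\<close> remains.\<close>

lemma tendsto_ln_sq_times_powr:
  fixes T p :: "'l \<Rightarrow> real"
  assumes T: "\<And>l. 0 \<le> T l" "(T \<longlongrightarrow> 0) F" and p: "\<And>l. 0 \<le> p l" "\<And>l. p l \<le> 1"
    and \<delta>: "0 < \<delta>" "((\<lambda>l. T l * p l powr (- \<delta>)) \<longlongrightarrow> 0) F" and e: "0 < e"
  shows "((\<lambda>l. (1 + (ln (p l))\<^sup>2) * T l powr e) \<longlongrightarrow> 0) F"
proof -
  let ?C = "(2 / (\<delta> * e))\<^sup>2"
  have "((\<lambda>l. T l powr e + ?C * (T l * p l powr (- \<delta>)) powr e) \<longlongrightarrow> 0 + ?C * 0) F"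
    using T \<delta> e by (intro tendsto_add tendsto_mult tendsto_const tendsto_zero_powrI[OF _ tendsto_const]) auto
  then have lim: "((\<lambda>l. T l powr e + ?C * (T l * p l powr (- \<delta>)) powr e) \<longlongrightarrow> 0) F"
    by simp
  show ?thesis
  proof (rule Lim_null_comparison[OF always_eventually lim], rule allI)
    fix l
    have "(ln (p l))\<^sup>2 * T l powr e \<le> ?C * (T l * p l powr (- \<delta>)) powr e"
    proof (cases "p l = 0")
      case False
      then have pos: "0 < p l" using p(1)[of l] by simp
      have "(ln (p l))\<^sup>2 * T l powr e = ((ln (p l))\<^sup>2 * p l powr (\<delta> * e)) * (T l * p l powr (- \<delta>)) powr e"
      proof -
        have "(T l * p l powr (- \<delta>)) powr e = T l powr e * p l powr (- (\<delta> * e))"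
          using T(1)[of l] by (simp add: powr_mult powr_powr)
        moreover have "p l powr (\<delta> * e) * p l powr (- (\<delta> * e)) = 1"
          using pos by (simp add: powr_add[symmetric])
        ultimately show ?thesis by (simp add: mult_ac)
      qed
      also have "\<dots> \<le> ?C * (T l * p l powr (- \<delta>)) powr e"
        using p \<delta> e by (intro mult_right_mono ln_sq_times_powr_le) auto
      finally show ?thesis .
    qed simp
    then show "norm ((1 + (ln (p l))\<^sup>2) * T l powr e) \<le> T l powr e + ?C * (T l * p l powr (- \<delta>)) powr e"
      by (simp add: algebra_simps abs_mult)
  qed
qed

text \<open>The factor \<open>T powr (2 - e)\<close> of \<open>T\<^sup>2\<close> is cancelled against the denominator by means of
  \<open>\<alpha> * T \<le> \<gamma>\<close>, which requires a nonnegative exponent. For \<open>\<epsilon> > 2\<close> the denominator is a negative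
  power of \<open>\<gamma> \<le> 1\<close>, hence at least \<open>1\<close>, which is its value at the cap \<open>e = 2\<close>.\<close>

lemma power2_div_powr_le:
  fixes \<alpha> T \<gamma> \<epsilon> :: real
  assumes "0 < \<alpha>" "0 \<le> T" "0 < \<gamma>" "\<gamma> \<le> 1" "\<alpha> * T \<le> \<gamma>"
  defines "e \<equiv> min \<epsilon> 2"
  shows "T\<^sup>2 / \<gamma> powr (2 - \<epsilon>) \<le> T powr e / \<alpha> powr (2 - e)"
proof (cases "T = 0")
  case False
  then have T: "0 < T" using assms by simp
  have "\<alpha> powr (2 - e) * T powr (2 - e) = (\<alpha> * T) powr (2 - e)"
    using assms by (simp add: powr_mult)
  also have "\<dots> \<le> \<gamma> powr (2 - e)"
    using assms by (intro powr_mono2) (auto simp: e_def)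
  also have "\<dots> \<le> \<gamma> powr (2 - \<epsilon>)"
    using assms by (intro powr_mono') (auto simp: e_def)
  finally have le: "\<alpha> powr (2 - e) * T powr (2 - e) \<le> \<gamma> powr (2 - \<epsilon>)" .
  have "T\<^sup>2 = T powr (2 - e) * T powr e"
    using T by (simp add: powr_add[symmetric])
  then have "T\<^sup>2 / \<gamma> powr (2 - \<epsilon>) = T powr e * (T powr (2 - e) / \<gamma> powr (2 - \<epsilon>))"
    by simp
  also have "\<dots> \<le> T powr e * (1 / \<alpha> powr (2 - e))"
    using le assms by (intro mult_left_mono) (auto simp: field_simps)
  finally show ?thesis by simp
qed simp

section \<open>Variance and workload of the estimators\<close>

text \<open>The variance is at most the second moment, which only grows when the factor \<open>a\<close> is dropped; the
  second moment of \<open>T\<close> is its mean square error plus the square of its mean. A finite relative error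
  at mean \<open>0\<close> forces \<open>T = 0\<close> almost everywhere, since in \<open>ennreal\<close> only \<open>0 / 0\<close> is finite among the
  quotients by \<open>0\<close>.\<close>

lemma (in prob_space) variance_bounded_times_le:
  assumes a: "a \<in> borel_measurable M" "\<And>w. 0 \<le> a w" "\<And>w. a w \<le> 1"
    and T: "integrable M T" and err: "sq_rel_err M T (expectation T) \<le> ennreal \<rho>" and \<rho>: "0 \<le> \<rho>"
  shows "variance (\<lambda>w. a w * T w) \<le> (1 + \<rho>) * (expectation T)\<^sup>2"
proof -
  define \<psi> where "\<psi> = expectation T"
  note [measurable] = a(1) borel_measurable_integrable[OF T]
  let ?x = "\<integral>\<^sup>+w. ennreal ((T w - \<psi>)\<^sup>2) \<partial>M"
  have x: "?x \<le> ennreal (\<rho> * \<psi>\<^sup>2)"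
  proof (cases "\<psi> = 0")
    case True
    then show ?thesis
      using err \<rho> by (cases "?x = 0") (auto simp: sq_rel_err_def \<psi>_def[symmetric] top_unique)
  next
    case False
    have "?x = ?x / ennreal (\<psi>\<^sup>2) * ennreal (\<psi>\<^sup>2)"
      using False by (simp add: ennreal_divide_times ennreal_mult_divide_eq)
    also have "\<dots> \<le> ennreal \<rho> * ennreal (\<psi>\<^sup>2)"
      using err by (intro mult_right_mono) (auto simp: sq_rel_err_def \<psi>_def)
    finally show ?thesis using \<rho> by (simp add: ennreal_mult)
  qed
  have int: "integrable M (\<lambda>w. (T w - \<psi>)\<^sup>2)"
    using x by (intro integrableI_bounded) (auto intro: le_less_trans)
  have "expectation (\<lambda>w. (T w - \<psi>)\<^sup>2) \<le> \<rho> * \<psi>\<^sup>2"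
    using x \<rho> int by (subst (asm) nn_integral_eq_integral) auto
  have T2: "(T w)\<^sup>2 = (T w - \<psi>)\<^sup>2 + (2 * \<psi> * T w - \<psi>\<^sup>2)" for w
    by (simp add: power2_eq_square algebra_simps)
  have intT2: "integrable M (\<lambda>w. (T w)\<^sup>2)"
    unfolding T2 using int T by (intro Bochner_Integration.integrable_add Bochner_Integration.integrable_diff) auto
  have "expectation (\<lambda>w. (T w)\<^sup>2) = expectation (\<lambda>w. (T w - \<psi>)\<^sup>2) + (2 * \<psi> * \<psi> - \<psi>\<^sup>2)"
    unfolding T2 using int T by (simp add: prob_space \<psi>_def)
  also have "\<dots> \<le> (1 + \<rho>) * \<psi>\<^sup>2"
    using \<open>expectation (\<lambda>w. (T w - \<psi>)\<^sup>2) \<le> \<rho> * \<psi>\<^sup>2\<close> by (simp add: power2_eq_square algebra_simps)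
  finally have ET2: "expectation (\<lambda>w. (T w)\<^sup>2) \<le> (1 + \<rho>) * \<psi>\<^sup>2" .
  have le: "\<bar>a w * T w\<bar> \<le> \<bar>T w\<bar>" for w
    using a(2,3)[of w] by (simp add: abs_mult mult_left_le_one_le)
  then have le2: "(a w * T w)\<^sup>2 \<le> (T w)\<^sup>2" for w
    by (simp add: abs_le_square_iff)
  have i1: "integrable M (\<lambda>w. a w * T w)"
    using le by (intro Bochner_Integration.integrable_bound[OF T]) auto
  have i2: "integrable M (\<lambda>w. (a w * T w)\<^sup>2)"
    using le2 by (intro Bochner_Integration.integrable_bound[OF intT2]) auto
  have "variance (\<lambda>w. a w * T w) \<le> expectation (\<lambda>w. (a w * T w)\<^sup>2)"
    by (subst variance_eq[OF i1 i2]) simp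
  also have "\<dots> \<le> expectation (\<lambda>w. (T w)\<^sup>2)"
    by (rule integral_mono[OF i2 intT2]) (rule le2)
  finally show ?thesis using ET2 by (simp add: \<psi>_def)
qed

lemma batch_mean_bounds:
  assumes "1 \<le> k"
  shows "0 \<le> batch_mean A M X k w" "batch_mean A M X k w \<le> 1"
proof -
  show "0 \<le> batch_mean A M X k w"
    by (simp add: batch_mean_def sum_nonneg)
  have "k * M - (k - 1) * M = M"
    using assms by (cases k) auto
  then have "(\<Sum>n = (k - 1) * M + 1..k * M. of_bool (X (n - 1) w \<notin> A \<and> X n w \<in> A)) \<le> real M"
    using sum_bounded_above[of "{(k - 1) * M + 1..k * M}" "\<lambda>n. of_bool (X (n - 1) w \<notin> A \<and> X n w \<in> A)" "1::real"]
    by simp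
  then show "batch_mean A M X k w \<le> 1"
    by (cases "M = 0") (auto simp: batch_mean_def)
qed

lemma batch_means_estimator_bounds:
  "0 \<le> batch_means_estimator A N b X w" "batch_means_estimator A N b X w \<le> 1"
proof -
  show "0 \<le> batch_means_estimator A N b X w"
    by (auto simp: batch_means_estimator_def intro!: divide_nonneg_nonneg sum_nonneg batch_mean_bounds(1))
  have "(\<Sum>k = 1..b. batch_mean A (N div b) X k w) \<le> real b"
    using sum_bounded_above[of "{1..b}" "\<lambda>k. batch_mean A (N div b) X k w" 1]
    by (simp add: batch_mean_bounds(2))
  then show "batch_means_estimator A N b X w \<le> 1"
    by (cases "b = 0") (auto simp: batch_means_estimator_def)
qed

text \<open>The value is \<open>\<rho>\<close> except in the degenerate case \<open>L = r = 0\<close>, where no levels are used and it is \<open>0\<close>.\<close>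

lemma mls_sq_rel_err_relaxed_opt_le:
  assumes "0 < \<rho>" "0 \<le> L" "0 \<le> r"
  shows "mls_sq_rel_err_relaxed (opt_m L) opt_p (opt_n_first \<rho> L r) (opt_n_last r) (r\<^sup>2) \<le> \<rho>"
proof (cases "0 < L \<or> 0 < r")
  case True
  then show ?thesis by (simp add: opt_closed_form(1)[OF assms])
next
  case False
  then show ?thesis using assms by (simp add: mls_sq_rel_err_relaxed_def opt_m_def)
qed

text \<open>The optimal workload is \<open>(q * L + r)\<^sup>2 / \<rho>\<close> with \<open>q = c / sqrt (2 * c - 1)\<close>, and a square of a sum is
  at most twice the sum of the squares.\<close>

lemma mls_workload_relaxed_opt_le:
  assumes "0 < \<rho>" "0 \<le> L" "0 \<le> r" "r \<le> R"
  shows "mls_workload_relaxed (opt_m L) opt_p (opt_n_first \<rho> L r) (opt_n_last r)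
    \<le> 2 / \<rho> * ((mls_c / sqrt (2 * mls_c - 1))\<^sup>2 + R\<^sup>2) * (1 + L\<^sup>2)"
proof -
  define q where "q = mls_c / sqrt (2 * mls_c - 1)"
  have "(q * L + r)\<^sup>2 \<le> 2 * ((q * L)\<^sup>2 + r\<^sup>2)"
    using zero_le_power2[of "q * L - r"] by (simp add: power2_eq_square algebra_simps)
  also have "\<dots> \<le> 2 * (q\<^sup>2 * L\<^sup>2 + R\<^sup>2)"
    using assms by (simp add: power_mult_distrib power_mono)
  also have "\<dots> \<le> 2 * ((q\<^sup>2 + R\<^sup>2) * (1 + L\<^sup>2))"
    by (simp add: algebra_simps)
  finally have "1 / \<rho> * (q * L + r)\<^sup>2 \<le> 1 / \<rho> * (2 * ((q\<^sup>2 + R\<^sup>2) * (1 + L\<^sup>2)))"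
    using assms by (intro mult_left_mono) auto
  also have "\<dots> = 2 / \<rho> * (q\<^sup>2 + R\<^sup>2) * (1 + L\<^sup>2)"
    by (simp only: mult.assoc[symmetric] times_divide_eq_left mult_1_left)
  finally show ?thesis
    unfolding opt_closed_form(2)[OF assms(1-3)] by (simp only: q_def times_divide_eq_left)
qed

section \<open>Logarithmic efficiency\<close>

theorem theorem3:
  fixes K :: "real ^ 'd \<Rightarrow> (real ^ 'd) measure"
    and \<mu> :: "(real ^ 'd) measure"
    and A :: "(real ^ 'd) set"
    and B :: "'l::linorder \<Rightarrow> (real ^ 'd) set"
    and \<Omega> :: "'w measure"
    and X :: "nat \<Rightarrow> 'w \<Rightarrow> real ^ 'd"
    and N b :: nat
    and W_alpha :: real
    and H :: "'l \<Rightarrow> real ^ 'd \<Rightarrow> real"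
    and m :: "'l \<Rightarrow> nat"
    and h :: "'l \<Rightarrow> nat \<Rightarrow> real"
    and cost :: "'l \<Rightarrow> nat \<Rightarrow> real ^ 'd \<Rightarrow> real"
    and \<rho> :: real
    and T_hat :: "'l \<Rightarrow> 'w \<Rightarrow> real"
    and W_T :: "'l \<Rightarrow> real"
  assumes chain: "positive_harris_chain K \<mu>"
    and A: "A \<in> sets borel" "0 < measure \<mu> A" "measure \<mu> A < 1"
    and B: "\<And>l. B l \<in> sets borel" "\<And>l. 0 < measure \<mu> (B l)"
      "((\<lambda>l. measure \<mu> (B l)) \<longlongrightarrow> 0) at_top"
    and \<Omega>: "prob_space \<Omega>"
    and path: "\<And>n. X n \<in> borel_measurable \<Omega>"
      "distr \<Omega> path_space (\<lambda>w n. X n w) = path_law K \<mu>"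
    and batches: "0 < b" "b \<le> N"
    and W_alpha: "0 \<le> W_alpha"
    and levels: "\<And>l. splitting_levels (H l) (m l) (h l) A (B l)"
    and \<rho>: "0 < \<rho>"
    and T_hat: "\<And>l. optimal_mls K \<mu> A (B l) (H l) (m l) (h l) (cost l) \<rho> \<Omega> (T_hat l) (W_T l)"
    and independent: "\<And>l. prob_space.indep_var \<Omega> borel (batch_means_estimator A N b X) borel (T_hat l)"
    and conditions: "\<And>l. condition_I K \<mu> A (H l) (m l) (h l)"
      "\<And>l. condition_II K \<mu> A (B l) (H l) (m l) (h l)"
    and costs: "\<And>l. unit_path_costs (m l) (cost l)"
    and asymptotics: "\<forall>\<^sub>F \<delta> in at_right (0::real).
      Limsup at_top (\<lambda>l. sq_rel_err_Rplus K \<mu> A (B l)) < \<infinity> \<and>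
      ((\<lambda>l. mean_visits K \<mu> A (B l) * hit_prob K \<mu> A (B l) powr (- \<delta>)) \<longlongrightarrow> 0) at_top"
  shows "\<forall>\<epsilon>>0. ((\<lambda>l. (W_alpha + W_T l) *
      prob_space.variance \<Omega> (\<lambda>w. batch_means_estimator A N b X w * T_hat l w) /
      measure \<mu> (B l) powr (2 - \<epsilon>)) \<longlongrightarrow> 0) at_top"
proof (intro allI impI)
  fix \<epsilon> :: real
  assume \<epsilon>: "0 < \<epsilon>"
  interpret stationary_chain K \<mu> by (rule positive_harris_stationary[OF chain])
  interpret \<Omega>: prob_space \<Omega> by (rule \<Omega>)
  define \<alpha> where "\<alpha> = cycle_rate K \<mu> A"
  define T where "T l = mean_visits K \<mu> A (B l)" for l
  define p where "p l = hit_prob K \<mu> A (B l)" for l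
  define \<gamma> where "\<gamma> l = measure \<mu> (B l)" for l
  define r where "r l = rel_err_Rplus K \<mu> A (B l)" for l
  define V where "V l = \<Omega>.variance (\<lambda>w. batch_means_estimator A N b X w * T_hat l w)" for l
  have \<alpha>: "0 < \<alpha>"
    unfolding \<alpha>_def by (rule cycle_rate_pos[OF chain A])
  have T0: "0 \<le> T l" for l
    by (simp add: T_def mean_visits_def integral_nonneg)
  have \<gamma>: "0 < \<gamma> l" "\<gamma> l \<le> 1" for l
    using B by (auto simp: \<gamma>_def)
  have \<alpha>T: "\<alpha> * T l \<le> \<gamma> l" for l
    using cycle_rate_mean_visits_le[OF A(1) B(1)] \<alpha> by (simp add: \<alpha>_def T_def \<gamma>_def)
  have p: "0 \<le> p l" "p l \<le> 1" for l
    using prob_space.prob_le_1[OF prob_space_cycle_law[OF A(1)]] \<alpha>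
    by (auto simp: p_def hit_prob_def \<alpha>_def)
  have r0: "0 \<le> r l" for l
    by (simp add: r_def rel_err_Rplus_def)
  have T_lim: "(T \<longlongrightarrow> 0) at_top"
  proof (rule Lim_null_comparison)
    show "\<forall>\<^sub>F l in at_top. norm (T l) \<le> \<gamma> l / \<alpha>"
      using T0 \<alpha>T \<alpha> by (intro always_eventually) (auto simp: field_simps)
    show "((\<lambda>l. \<gamma> l / \<alpha>) \<longlongrightarrow> 0) at_top"
      unfolding \<gamma>_def using B(3) by (rule tendsto_divide_zero)
  qed
  from eventually_happens'[OF trivial_limit_at_right_real eventually_conj[OF asymptotics eventually_at_right_less]]
  obtain \<delta> :: real where \<delta>: "0 < \<delta>" "((\<lambda>l. T l * p l powr (- \<delta>)) \<longlongrightarrow> 0) at_top"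
    and limsup: "Limsup at_top (\<lambda>l. sq_rel_err_Rplus K \<mu> A (B l)) < \<infinity>"
    by (auto simp: T_def p_def)
  obtain c where c: "Limsup at_top (\<lambda>l. sq_rel_err_Rplus K \<mu> A (B l)) < c" "c < \<infinity>"
    using dense[OF limsup] by blast
  define R where "R = sqrt (enn2real c)"
  have R: "\<forall>\<^sub>F l in at_top. r l \<le> R"
    using Limsup_lessD[OF c(1)]
  proof eventually_elim
    case (elim l)
    then show ?case
      using c(2) by (auto simp: r_def R_def rel_err_Rplus_def intro!: enn2real_mono)
  qed
  define C where "C = W_alpha + 2 / \<rho> * ((mls_c / sqrt (2 * mls_c - 1))\<^sup>2 + R\<^sup>2)"
  have C0: "0 \<le> C" using W_alpha \<rho> by (simp add: C_def)
  have W: "W_T l = mls_workload_relaxed (opt_m \<bar>ln (p l)\<bar>) opt_p (opt_n_first \<rho> \<bar>ln (p l)\<bar> (r l)) (opt_n_last (r l))" for l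
    using T_hat[of l] costs[of l] by (simp add: optimal_mls_def Let_def p_def r_def)
  have W0: "0 \<le> W_T l" for l
    unfolding W opt_closed_form(2)[OF \<rho> abs_ge_zero r0] using \<rho> by simp
  have W_le: "W_alpha + W_T l \<le> C * (1 + (ln (p l))\<^sup>2)" if "r l \<le> R" for l
  proof -
    have "W_T l \<le> 2 / \<rho> * ((mls_c / sqrt (2 * mls_c - 1))\<^sup>2 + R\<^sup>2) * (1 + (ln (p l))\<^sup>2)"
      using mls_workload_relaxed_opt_le[OF \<rho> abs_ge_zero r0 that, of "ln (p l)"] by (simp add: W)
    moreover have "W_alpha * 1 \<le> W_alpha * (1 + (ln (p l))\<^sup>2)"
      using W_alpha by (intro mult_left_mono) auto
    ultimately show ?thesis unfolding C_def by (simp only: distrib_right)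
  qed
  have V0: "0 \<le> V l" for l
    by (simp add: V_def integral_nonneg)
  have V_le: "V l \<le> (1 + \<rho>) * (T l)\<^sup>2" for l
  proof -
    have Tl: "integrable \<Omega> (T_hat l)" "\<Omega>.expectation (T_hat l) = T l"
      and err: "sq_rel_err \<Omega> (T_hat l) (T l) = ennreal (mls_sq_rel_err_relaxed (opt_m \<bar>ln (p l)\<bar>) opt_p
        (opt_n_first \<rho> \<bar>ln (p l)\<bar> (r l)) (opt_n_last (r l)) ((r l)\<^sup>2))"
      using T_hat[of l] conditions[of l] by (simp_all add: optimal_mls_def Let_def T_def p_def r_def)
    have "sq_rel_err \<Omega> (T_hat l) (T l) \<le> ennreal \<rho>"
      unfolding err by (intro ennreal_leI mls_sq_rel_err_relaxed_opt_le \<rho> r0 abs_ge_zero)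
    then show ?thesis
      using \<Omega>.variance_bounded_times_le[OF \<Omega>.indep_var_rv1[OF independent[of l]] batch_means_estimator_bounds Tl(1)] \<rho>
      by (simp add: V_def Tl(2))
  qed
  define e where "e = min \<epsilon> 2"
  define D where "D = C * (1 + \<rho>) / \<alpha> powr (2 - e)"
  have "((\<lambda>l. D * ((1 + (ln (p l))\<^sup>2) * T l powr e)) \<longlongrightarrow> 0) at_top"
    using \<epsilon> by (intro tendsto_mult_right_zero tendsto_ln_sq_times_powr[OF T0 T_lim p \<delta>]) (simp add: e_def)
  then have "((\<lambda>l. (W_alpha + W_T l) * V l / \<gamma> l powr (2 - \<epsilon>)) \<longlongrightarrow> 0) at_top"
  proof (rule Lim_null_comparison[rotated])
    show "\<forall>\<^sub>F l in at_top. norm ((W_alpha + W_T l) * V l / \<gamma> l powr (2 - \<epsilon>)) \<le> D * ((1 + (ln (p l))\<^sup>2) * T l powr e)"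
      using R
    proof eventually_elim
      case (elim l)
      have "norm ((W_alpha + W_T l) * V l / \<gamma> l powr (2 - \<epsilon>)) = (W_alpha + W_T l) * V l / \<gamma> l powr (2 - \<epsilon>)"
        using W_alpha W0[of l] V0[of l] by simp
      also have "\<dots> \<le> (C * (1 + (ln (p l))\<^sup>2)) * ((1 + \<rho>) * (T l)\<^sup>2) / \<gamma> l powr (2 - \<epsilon>)"
        using W_le[OF elim] V_le[of l] V0[of l] C0 by (intro divide_right_mono mult_mono) auto
      also have "\<dots> = (C * (1 + (ln (p l))\<^sup>2) * (1 + \<rho>)) * ((T l)\<^sup>2 / \<gamma> l powr (2 - \<epsilon>))"
        by simp
      also have "\<dots> \<le> (C * (1 + (ln (p l))\<^sup>2) * (1 + \<rho>)) * (T l powr e / \<alpha> powr (2 - e))"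
        unfolding e_def using C0 \<rho> by (intro mult_left_mono power2_div_powr_le \<alpha> T0 \<gamma> \<alpha>T) auto
      also have "\<dots> = D * ((1 + (ln (p l))\<^sup>2) * T l powr e)"
        by (simp add: D_def)
      finally show ?case .
    qed
  qed
  then show "((\<lambda>l. (W_alpha + W_T l) * \<Omega>.variance (\<lambda>w. batch_means_estimator A N b X w * T_hat l w) /
      measure \<mu> (B l) powr (2 - \<epsilon>)) \<longlongrightarrow> 0) at_top"
    by (simp add: V_def \<gamma>_def)
qed

end
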